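(* Let $q$ be a power of an odd prime, let $n\ge 4$ be even, and let $f\in\mathbb{F}_q[x_1,\dots,x_n]$ be a non-degenerate quadratic form such that $(-1)^{n/2}\det(f)$ is a square in $\mathbb{F}_q^\times$. Let $X=V(f)\subseteq\mathbb{P}^{n-1}$. Then for every integer $P\ge 1$: if $n=4$, $$\#\mathrm{Mor}_P(\mathbb{P}^1,X)(\mathbb{F}_q)=\frac{(q^2-1)^2}{q^2}\,P\,q^{2P}+\frac{(q^2-1)(q+1)^2}{q^2}\,q^{2P},$$ and if $n\ge 6$, $$\#\mathrm{Mor}_P(\mathbb{P}^1,X)(\mathbb{F}_q)=\frac{(q^{n/2}-1)(q^{n-2}-1)(q^{n-3}-1)}{q^{n-2}(q^{n/2-2}-1)(q-1)}\,q^{P(n-2)}-\frac{(q^{n-2}-1)(q^{n/2}-1)}{q^{n/2}(q^{n/2-2}-1)}\,q^{\frac n2 P}.$$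
   Context: $\det(f)$ denotes the determinant of the symmetric matrix $A\in\mathbb{F}_q^{n\times n}$ with $f(\mathbf{x})=\mathbf{x}^TA\mathbf{x}$; non-degenerate means $\det(f)\neq0$. $\#\mathrm{Mor}_P(\mathbb{P}^1,X)(\mathbb{F}_q)$ denotes the number of morphisms $\mathbb{P}^1\to X$ of degree exactly $P$ defined over $\mathbb{F}_q$; equivalently, it is the number of vectors $(x_1,\dots,x_n)\in\mathbb{F}_q[t]^n$ with $\gcd(x_1,\dots,x_n)=1$, $\max_i\deg(x_i)=P$ and $f(x_1,\dots,x_n)=0$, counted modulo multiplication by scalars in $\mathbb{F}_q^\times$ (i.e. this number divided by $q-1$). *)

theory Defs
  imports "HOL-Analysis.Analysis" "HOL-Computational_Algebra.Polynomial"
begin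

definition qf_poly :: "'a::comm_ring_1 ^'n ^'n \<Rightarrow> 'a poly ^'n \<Rightarrow> 'a poly" where
  "qf_poly A x = (\<Sum>i\<in>UNIV. \<Sum>j\<in>UNIV. [:A $ i $ j:] * x $ i * x $ j)"

definition mor_vectors :: "'a::{field,finite} ^'n ^'n \<Rightarrow> nat \<Rightarrow> ('a poly ^'n) set" where
  "mor_vectors A P = {x. (\<forall>d. (\<forall>i. d dvd x $ i) \<longrightarrow> is_unit d)
                        \<and> Max (range (\<lambda>i. degree (x $ i))) = P
                        \<and> qf_poly A x = 0}"

text \<open>Number of degree-P morphisms P^1 -> X over F_q: the count of such vectors
  modulo scalars in F_q^*, i.e. divided by q - 1.\<close>
definition num_mor :: "'a::{field,finite} ^'n ^'n \<Rightarrow> nat \<Rightarrow> real" where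
  "num_mor A P = real (card (mor_vectors A P)) / (real CARD('a) - 1)"

end

theory Submission
  imports Defs
begin

text \<open>
  Over a finite field the discriminant condition makes \<open>f\<close> congruent to the hyperbolic form
  \<open>\<Sum>\<^sub>h u\<^sub>h v\<^sub>h\<close> in \<open>m = n/2\<close> pairs of variables. Let \<open>V\<^sub>k\<close> be the space of polynomials of degree
  below \<open>k\<close>. A polynomial \<open>\<alpha> \<in> V\<^bsub>2k-1\<^esub>\<close> acts on \<open>V\<^bsub>2k-1\<^esub>\<close> as the functional taking \<open>w\<close> to the coefficient
  of \<open>t\<close> to the power \<open>2k-2\<close> in \<open>\<alpha> w\<close>, and double counting the pairs of \<open>\<alpha>\<close> and \<open>(u, v)\<close> such that \<open>\<alpha>\<close> kills
  \<open>\<Sum>\<^sub>h u\<^sub>h v\<^sub>h\<close> (a circle method without characters) expresses the number of zeros of \<open>f\<close> with entries in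
  \<open>V\<^sub>k\<close> by the \<open>m\<close>-th moment of the kernel sizes of the Hankel matrices attached to all \<open>\<alpha>\<close>.

  For fixed \<open>\<alpha>\<close> the kernel dimension is a convex function of the number of columns, and its slopes are at
  most 1 up to the square matrix. Hence the kernel dimension grows by exactly 1 per column once it is
  positive, so the first moment, which is elementary, already determines the distribution of the ranks
  and with it all other moments.

  Every nonzero zero is uniquely a monic polynomial times a primitive zero. Inverting this relation turns
  the number of all zeros into the number of morphisms of degree \<open>P\<close>.
\<close>

subsection \<open>Kernels of Hankel matrices\<close>

text \<open>The map \<open>\<tau> (d' - d)\<close> embeds the fibre over \<open>d\<close> into the
  fibre over \<open>d'\<close>, so all fibres of \<open>\<phi>\<close> have the same size. This
  stands in for rank arguments: one nontrivial linear condition divides a count by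
  \<open>CARD('a)\<close>.\<close>

lemma card_eq_card_zero_fibre:
  fixes \<phi> :: "'b \<Rightarrow> 'a::{ab_group_add,finite}"
  assumes fin: "finite X"
    and clo: "\<And>c x. x \<in> X \<Longrightarrow> \<tau> c x \<in> X"
    and inj: "\<And>c. inj_on (\<tau> c) X"
    and shift: "\<And>c x. x \<in> X \<Longrightarrow> \<phi> (\<tau> c x) = \<phi> x + c"
  shows "card X = CARD('a) * card {x \<in> X. \<phi> x = 0}"
proof -
  have le: "card {x \<in> X. \<phi> x = d} \<le> card {x \<in> X. \<phi> x = d'}" for d d'
  proof (rule card_inj_on_le)
    show "inj_on (\<tau> (d' - d)) {x \<in> X. \<phi> x = d}"
      using inj by (rule inj_on_subset) auto
    show "\<tau> (d' - d) ` {x \<in> X. \<phi> x = d} \<subseteq> {x \<in> X. \<phi> x = d'}"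
      using clo shift by auto
  qed (use fin in auto)
  have "card X = card (\<Union>d\<in>UNIV. {x \<in> X. \<phi> x = d})"
    by (rule arg_cong[where f = card]) auto
  also have "\<dots> = (\<Sum>d\<in>UNIV. card {x \<in> X. \<phi> x = d})"
    by (rule card_UN_disjoint) (use fin in auto)
  also have "\<dots> = (\<Sum>d\<in>(UNIV::'a set). card {x \<in> X. \<phi> x = 0})"
    by (rule sum.cong) (use le in \<open>auto intro!: antisym\<close>)
  finally show ?thesis by simp
qed

text \<open>The bound is put on coefficients because \<open>degree 0 = 0\<close>: this way the space
  has dimension \<open>k\<close> for \<open>k = 0\<close> as well.\<close>

definition polys_below :: "nat \<Rightarrow> 'a::zero poly set" where
  "polys_below k = {p. \<forall>i\<ge>k. coeff p i = 0}"

lemma polys_below_0 [simp]: "polys_below 0 = {0}"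
  by (auto simp: polys_below_def poly_eq_iff)

lemma polys_below_Suc: "polys_below (Suc k) = (\<lambda>(a, p). pCons a p) ` (UNIV \<times> polys_below k)"
proof (intro equalityI subsetI)
  fix p :: "'a poly" assume p: "p \<in> polys_below (Suc k)"
  obtain a r where pr: "p = pCons a r" by (rule pCons_cases)
  have "coeff r i = 0" if "i \<ge> k" for i
  proof -
    have "coeff p (Suc i) = 0" using p that unfolding polys_below_def by blast
    then show ?thesis by (simp add: pr)
  qed
  then have "(a, r) \<in> UNIV \<times> polys_below k" by (simp add: polys_below_def)
  then show "p \<in> (\<lambda>(a, p). pCons a p) ` (UNIV \<times> polys_below k)"
    by (rule rev_image_eqI) (simp add: pr)
next
  fix p :: "'a poly" assume "p \<in> (\<lambda>(a, p). pCons a p) ` (UNIV \<times> polys_below k)"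
  then obtain a r where pr: "p = pCons a r" and r: "r \<in> polys_below k" by auto
  show "p \<in> polys_below (Suc k)"
    unfolding polys_below_def
  proof clarify
    fix i assume "Suc k \<le> i"
    then obtain j where "i = Suc j" "k \<le> j" by (cases i) auto
    then show "coeff p i = 0" using r by (simp add: pr polys_below_def)
  qed
qed

lemma finite_card_polys_below:
  "finite (polys_below k :: 'a::{zero,finite} poly set) \<and>
   card (polys_below k :: 'a poly set) = CARD('a) ^ k"
proof (induction k)
  case (Suc k)
  have "inj_on (\<lambda>(a, p). pCons a p) (UNIV \<times> (polys_below k :: 'a poly set))"
    by (auto simp: inj_on_def)
  then show ?case
    using Suc by (simp add: polys_below_Suc card_image card_cartesian_product)
qed simp

lemmas finite_polys_below [simp] = finite_card_polys_below[THEN conjunct1]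
lemmas card_polys_below = finite_card_polys_below[THEN conjunct2]

lemma polys_below_iff_degree:
  "p \<in> polys_below (Suc k) \<longleftrightarrow> degree p \<le> k"
  unfolding polys_below_def
  by (auto intro!: degree_le simp: coeff_eq_0 Suc_le_eq)

lemma zero_in_polys_below [simp]: "0 \<in> polys_below k"
  by (simp add: polys_below_def)

lemma add_in_polys_below: "p \<in> polys_below k \<Longrightarrow> r \<in> polys_below k \<Longrightarrow> p + r \<in> polys_below k"
  by (simp add: polys_below_def)

lemma diff_in_polys_below:
  fixes p :: "'a::ab_group_add poly"
  shows "p \<in> polys_below k \<Longrightarrow> r \<in> polys_below k \<Longrightarrow> p - r \<in> polys_below k"
  by (simp add: polys_below_def)

lemma smult_in_polys_below: "p \<in> polys_below k \<Longrightarrow> smult c p \<in> polys_below k"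
  by (simp add: polys_below_def)

text \<open>Among the subspaces whose size is a power of \<open>CARD('a)\<close>, take a largest one
  \<open>U\<close>. A vector \<open>v\<close> of \<open>S\<close> outside \<open>U\<close> would
  give the subspace of all \<open>smult c v + u\<close>, which is larger by the factor
  \<open>CARD('a)\<close>.\<close>

lemma card_subspace_poly:
  fixes S :: "'a::{field,finite} poly set"
  assumes fin: "finite S" and zero: "0 \<in> S"
    and add: "\<And>x y. x \<in> S \<Longrightarrow> y \<in> S \<Longrightarrow> x + y \<in> S"
    and smult: "\<And>c x. x \<in> S \<Longrightarrow> smult c x \<in> S"
  shows "\<exists>d. card S = CARD('a) ^ d"
proof -
  define sub where "sub U \<longleftrightarrow> U \<subseteq> S \<and> 0 \<in> U \<and> (\<forall>x\<in>U. \<forall>y\<in>U. x + y \<in> U) \<and>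
     (\<forall>c. \<forall>x\<in>U. smult c x \<in> U) \<and> (\<exists>d. card U = CARD('a) ^ d)" for U
  have "sub {0}" unfolding sub_def using zero by (auto intro: exI[of _ 0])
  then obtain U where U: "sub U" and mx: "\<And>U'. sub U' \<Longrightarrow> card U' \<le> card U"
    using ex_has_greatest_nat[of sub "{0}" card "Suc (card S)"]
    by (metis card_mono fin le_imp_less_Suc sub_def nat_less_le)
  have "U = S"
  proof (rule ccontr)
    assume "U \<noteq> S"
    then obtain v where v: "v \<in> S" "v \<notin> U" using U by (auto simp: sub_def)
    define U' where "U' = (\<lambda>(c, u). smult c v + u) ` (UNIV \<times> U)"
    have diffU: "x - y \<in> U" if "x \<in> U" "y \<in> U" for x y
    proof -
      have "x + smult (-1) y \<in> U" using U that by (simp only: sub_def)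
      then show ?thesis by simp
    qed
    have inj: "inj_on (\<lambda>(c, u). smult c v + u) (UNIV \<times> U)"
    proof (rule inj_onI, clarify)
      fix c u c' u' assume uu: "u \<in> U" "u' \<in> U" and eq: "smult c v + u = smult c' v + u'"
      have "smult (c - c') v = u' - u" using eq by (simp add: smult_diff_left algebra_simps)
      then have "smult (c - c') v \<in> U" using diffU uu by simp
      then have "smult (1 / (c - c')) (smult (c - c') v) \<in> U" using U by (simp only: sub_def)
      then have "c = c'" using v by (cases "c = c'") auto
      then show "c = c' \<and> u = u'" using eq by simp
    qed
    obtain d where d: "card U = CARD('a) ^ d" using U by (auto simp: sub_def)
    have finU: "finite U" using U fin by (auto simp: sub_def intro: finite_subset)
    have card: "card U' = CARD('a) * card U"
      unfolding U'_def using card_image[OF inj] by (simp add: card_cartesian_product)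
    have mem: "smult c v + u \<in> U'" if "u \<in> U" for c u using that by (auto simp: U'_def)
    have "sub U'"
      unfolding sub_def
    proof (intro conjI ballI allI)
      show "U' \<subseteq> S" using U v add smult by (auto simp: U'_def sub_def)
      show "0 \<in> U'" using mem[of 0 0] U by (simp add: sub_def)
      show "\<exists>d. card U' = CARD('a) ^ d" using card d by (intro exI[of _ "Suc d"]) simp
    next
      fix x y assume "x \<in> U'" "y \<in> U'"
      then obtain c u c' u' where "x = smult c v + u" "y = smult c' v + u'" "u \<in> U" "u' \<in> U"
        by (auto simp: U'_def)
      then show "x + y \<in> U'" using mem[of "u + u'" "c + c'"] U
        by (simp add: sub_def smult_add_left algebra_simps)
    next
      fix e x assume "x \<in> U'"
      then obtain c u where "x = smult c v + u" "u \<in> U" by (auto simp: U'_def)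
      then show "smult e x \<in> U'" using mem[of "smult e u" "e * c"] U
        by (simp add: sub_def smult_add_right)
    qed
    from mx[OF this] have "CARD('a) * card U \<le> card U" using card by simp
    moreover have "card U > 0" using d finU by simp
    moreover have "CARD('a) \<ge> 2" using card_mono[of UNIV "{0::'a,1}"] by simp
    ultimately show False by (metis mult_le_cancel2 nat_mult_1 not_less_eq_eq numeral_2_eq_2 One_nat_def)
  qed
  then show ?thesis using U by (auto simp: sub_def)
qed

text \<open>
  The kernel of the Hankel matrix of \<open>\<alpha>\<close> with \<open>k\<close> columns and \<open>M + 1 - k\<close> rows. The coefficients of \<open>\<alpha>\<close>
  enter in reversed order, which makes the matrix product a polynomial product.
\<close>

definition hankel_kernel :: "nat \<Rightarrow> 'a::comm_ring_1 poly \<Rightarrow> nat \<Rightarrow> 'a poly set" where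
  "hankel_kernel M \<alpha> k = {x \<in> polys_below k. \<forall>i. k \<le> Suc i \<and> i < M \<longrightarrow> coeff (\<alpha> * x) i = 0}"

lemma finite_hankel_kernel [simp]:
  "finite (hankel_kernel M (\<alpha> :: 'a::{field,finite} poly) k)"
  unfolding hankel_kernel_def by simp

lemma hankel_kernel_0 [simp]: "hankel_kernel M \<alpha> 0 = {0}"
  by (auto simp: hankel_kernel_def)

lemma hankel_kernel_Suc: "hankel_kernel M \<alpha> (Suc M) = polys_below (Suc M)"
  by (auto simp: hankel_kernel_def)

lemma hankel_kernel_mono: "hankel_kernel M \<alpha> k \<subseteq> hankel_kernel M \<alpha> (Suc k)"
  by (auto simp: hankel_kernel_def polys_below_def)

lemma zero_in_hankel_kernel: "0 \<in> hankel_kernel M \<alpha> k"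
  by (simp add: hankel_kernel_def)

lemma diff_in_hankel_kernel:
  "x \<in> hankel_kernel M \<alpha> k \<Longrightarrow> y \<in> hankel_kernel M \<alpha> k \<Longrightarrow> x - y \<in> hankel_kernel M \<alpha> k"
  by (simp add: hankel_kernel_def diff_in_polys_below right_diff_distrib)

lemma card_hankel_kernel_power:
  fixes \<alpha> :: "'a::{field,finite} poly"
  shows "\<exists>d. card (hankel_kernel M \<alpha> k) = CARD('a) ^ d"
proof -
  let ?K = "hankel_kernel M \<alpha> k"
  have "x + y \<in> ?K" if "x \<in> ?K" "y \<in> ?K" for x y
    using that by (simp add: hankel_kernel_def add_in_polys_below distrib_left)
  moreover have "smult c x \<in> ?K" if "x \<in> ?K" for c x
    using that by (simp add: hankel_kernel_def smult_in_polys_below)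
  ultimately show ?thesis
    by (intro card_subspace_poly finite_hankel_kernel zero_in_hankel_kernel)
qed

text \<open>
  Shifting by the variable maps \<open>K\<^bsub>k+1\<^esub>\<close> into \<open>K\<^bsub>k+2\<^esub>\<close>, and \<open>K\<^bsub>k+1\<^esub> \<inter> t K\<^bsub>k+1\<^esub> = t K\<^sub>k\<close>.
\<close>

lemma hankel_kernel_convex:
  fixes \<alpha> :: "'a::{field,finite} poly"
  assumes "k < M"
  shows "card (hankel_kernel M \<alpha> (Suc k)) ^ 2
    \<le> card (hankel_kernel M \<alpha> k) * card (hankel_kernel M \<alpha> (Suc (Suc k)))"
proof -
  \<comment> \<open>The sum map on two copies of \<open>?K (Suc k)\<close>, the second one shifted.
    Its fibres embed into \<open>?K k\<close> and its image lies in \<open>?K (Suc (Suc k))\<close>,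
    which gives the inequality.\<close>
  define f where "f = (\<lambda>(x, y). x + pCons 0 y :: 'a poly)"
  let ?K = "hankel_kernel M \<alpha>"
  let ?A = "?K (Suc k) \<times> ?K (Suc k)"
  have fin: "finite ?A" by simp
  have fib: "card {p \<in> ?A. f p = z} \<le> card (?K k)" if "z \<in> f ` ?A" for z
  proof -
    from that obtain x0 y0 where x0: "x0 \<in> ?K (Suc k)" and y0: "y0 \<in> ?K (Suc k)"
      and z: "z = x0 + pCons 0 y0" by (auto simp: f_def)
    show ?thesis
    proof (rule card_inj_on_le)
      show "inj_on (\<lambda>(x, y). y - y0) {p \<in> ?A. f p = z}"
        by (auto simp: inj_on_def f_def)
      show "(\<lambda>(x, y). y - y0) ` {p \<in> ?A. f p = z} \<subseteq> ?K k"
      proof (rule image_subsetI)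
        fix p assume "p \<in> {p \<in> ?A. f p = z}"
        then obtain x y where xy: "p = (x, y)" and x: "x \<in> ?K (Suc k)" and y: "y \<in> ?K (Suc k)"
          and "f (x, y) = z" by blast
        then have "x + pCons 0 y = x0 + pCons 0 y0" by (simp add: f_def z)
        then have "pCons 0 y = x0 + pCons 0 y0 - x" by (metis add_diff_cancel_left')
        then have "pCons 0 y - pCons 0 y0 = x0 - x" by (simp del: diff_pCons)
        then have eq: "pCons 0 (y - y0) = x0 - x" by simp
        have "x0 - x \<in> ?K (Suc k)" using x x0 by (simp add: diff_in_hankel_kernel)
        then have p: "pCons 0 (y - y0) \<in> ?K (Suc k)" by (simp add: eq)
        have d: "y - y0 \<in> ?K (Suc k)" using y y0 by (simp add: diff_in_hankel_kernel)
        have "y - y0 \<in> polys_below k"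
          unfolding polys_below_def
        proof clarify
          fix i assume "i \<ge> k"
          then have "coeff (pCons 0 (y - y0)) (Suc i) = 0"
            using p unfolding hankel_kernel_def polys_below_def by blast
          then show "coeff (y - y0) i = 0" by simp
        qed
        \<comment> \<open>The shifted polynomial controls all coefficients except the one at
          \<open>i = M - 1\<close>, which would need the index \<open>M\<close>. That one comes from
          \<open>y - y0\<close> lying in \<open>?K (Suc k)\<close>, and here \<open>k < M\<close>
          matters.\<close>
        moreover have "coeff (\<alpha> * (y - y0)) i = 0" if "k \<le> Suc i" "i < M" for i
        proof (cases "Suc i < M")
          case True
          then have "coeff (\<alpha> * pCons 0 (y - y0)) (Suc i) = 0"
            using p that unfolding hankel_kernel_def by auto
          then show ?thesis by simp
        next
          case False
          then have "Suc k \<le> Suc i" using assms that by simp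
          then show ?thesis using d that unfolding hankel_kernel_def by blast
        qed
        ultimately show "(case p of (x, y) \<Rightarrow> y - y0) \<in> ?K k" by (simp add: hankel_kernel_def xy)
      qed
      show "finite (?K k)" by (rule finite_hankel_kernel)
    qed
  qed
  have "f ` ?A \<subseteq> ?K (Suc (Suc k))"
  proof (rule image_subsetI)
    fix p assume "p \<in> ?A"
    then obtain x y where p: "p = (x, y)" and x: "x \<in> ?K (Suc k)" and y: "y \<in> ?K (Suc k)" by blast
    have "coeff (\<alpha> * (x + pCons 0 y)) i = 0" if "Suc (Suc k) \<le> Suc i" "i < M" for i
    proof -
      from that obtain j where j: "i = Suc j" "Suc k \<le> Suc j" "j < M" by (cases i) auto
      have "coeff (\<alpha> * x) i = 0" "coeff (\<alpha> * y) j = 0"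
        using x y j that unfolding hankel_kernel_def by auto
      then show ?thesis by (simp add: j distrib_left)
    qed
    moreover have "x + pCons 0 y \<in> polys_below (Suc (Suc k))"
    proof (rule add_in_polys_below)
      show "x \<in> polys_below (Suc (Suc k))"
        using x by (simp add: hankel_kernel_def polys_below_def)
      show "pCons 0 y \<in> polys_below (Suc (Suc k))"
        using y by (subst polys_below_Suc) (auto simp: hankel_kernel_def)
    qed
    ultimately show "f p \<in> ?K (Suc (Suc k))" by (simp add: hankel_kernel_def f_def p)
  qed
  then have le: "card (f ` ?A) \<le> card (?K (Suc (Suc k)))" by (simp add: card_mono)
  have "card (?K (Suc k)) ^ 2 = card ?A" by (simp add: card_cartesian_product power2_eq_square)
  also have "?A = (\<Union>z\<in>f ` ?A. {p \<in> ?A. f p = z})" by auto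
  also have "card \<dots> \<le> (\<Sum>z\<in>f ` ?A. card {p \<in> ?A. f p = z})"
    by (rule card_UN_le) simp
  also have "\<dots> \<le> (\<Sum>z\<in>f ` ?A. card (?K k))" by (rule sum_mono) (rule fib)
  also have "\<dots> \<le> card (?K k) * card (?K (Suc (Suc k)))" using le by simp
  finally show ?thesis .
qed

section \<open>Growth of the kernel dimension with the number of columns\<close>

lemma convex_slopes:
  fixes \<kappa> :: "nat \<Rightarrow> nat"
  assumes zero: "\<kappa> 0 = 0" and top: "\<kappa> (Suc M) = Suc M"
    and convex: "\<And>k. k < M \<Longrightarrow> 2 * \<kappa> (Suc k) \<le> \<kappa> k + \<kappa> (Suc (Suc k))"
    and k: "2 * k \<le> M"
  shows convex_slope_le: "\<kappa> (Suc k) \<le> Suc (\<kappa> k)"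
    and convex_slope_ge: "\<kappa> k > 0 \<Longrightarrow> \<kappa> (Suc k) \<ge> Suc (\<kappa> k)"
proof -
  show "\<kappa> (Suc k) \<le> Suc (\<kappa> k)"
  proof (rule ccontr)
    assume "\<not> ?thesis"
    then have start: "\<kappa> (Suc k) \<ge> \<kappa> k + 2" by simp
    \<comment> \<open>By convexity a slope of at least 2 at \<open>k\<close> persists up to
      \<open>M\<close>. Then \<open>\<kappa> (Suc M)\<close> is at least
      \<open>2 * (Suc M - k)\<close>, which exceeds \<open>Suc M\<close> because
      \<open>2 * k \<le> M\<close>.\<close>
    have step: "k + j \<le> M \<Longrightarrow> \<kappa> (Suc (k + j)) \<ge> \<kappa> (k + j) + 2" for j
    proof (induction j)
      case (Suc j)
      then show ?case using convex[of "k + j"] by simp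
    qed (use start in simp)
    have "k + j \<le> Suc M \<Longrightarrow> \<kappa> (k + j) \<ge> \<kappa> k + 2 * j" for j
    proof (induction j)
      case (Suc j)
      then show ?case using step[of j] by simp
    qed simp
    from this[of "Suc M - k"] show False using k top by simp
  qed
  \<comment> \<open>The first step away from 0 has slope at least 1 because the values are integers,
    and convexity keeps the later slopes at least as large.\<close>
  have "k \<le> M \<Longrightarrow> \<kappa> k > 0 \<Longrightarrow> \<kappa> (Suc k) \<ge> Suc (\<kappa> k)"
  proof (induction k)
    case (Suc k)
    then show ?case using convex[of k] by (cases "\<kappa> k = 0") auto
  qed (use zero in simp)
  then show "\<kappa> k > 0 \<Longrightarrow> \<kappa> (Suc k) \<ge> Suc (\<kappa> k)" using k by simp
qed

lemma CARD_ge_2: "CARD('a::{zero_neq_one,finite}) \<ge> 2"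
  by (rule order_trans[OF _ card_mono[of UNIV "{0::'a, 1}"]]) auto

text \<open>Here \<open>\<kappa>\<close> is the kernel dimension. Its increments are 0 or 1, and the
  increment 0 is possible only while the dimension is still 0.\<close>

lemma card_hankel_kernel_Suc:
  fixes \<alpha> :: "'a::{field,finite} poly" and M k :: nat
  assumes k: "2 * k \<le> M"
  defines "c \<equiv> \<lambda>j. card (hankel_kernel M \<alpha> j)"
  shows "c (Suc k) = CARD('a) * c k \<or> c k = 1 \<and> c (Suc k) = 1"
proof -
  have q: "CARD('a) > 1" using CARD_ge_2[where 'a='a] by simp
  obtain \<kappa> where \<kappa>: "\<And>j. c j = CARD('a) ^ \<kappa> j"
    using card_hankel_kernel_power[of M \<alpha>] unfolding c_def by metis
  have "CARD('a) ^ \<kappa> 0 = CARD('a) ^ 0" using \<kappa>[of 0] by (simp add: c_def)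
  then have 0: "\<kappa> 0 = 0" using q power_inject_exp by blast
  have "CARD('a) ^ \<kappa> (Suc M) = CARD('a) ^ Suc M"
    using \<kappa>[of "Suc M"] unfolding c_def hankel_kernel_Suc card_polys_below by simp
  then have 1: "\<kappa> (Suc M) = Suc M" using q power_inject_exp by blast
  have 2: "2 * \<kappa> (Suc j) \<le> \<kappa> j + \<kappa> (Suc (Suc j))" if "j < M" for j
  proof -
    have "c (Suc j) ^ 2 \<le> c j * c (Suc (Suc j))"
      unfolding c_def using that by (rule hankel_kernel_convex)
    then have "CARD('a) ^ (\<kappa> (Suc j) * 2) \<le> CARD('a) ^ (\<kappa> j + \<kappa> (Suc (Suc j)))"
      unfolding \<kappa> power_mult[symmetric] power_add[symmetric] .
    then show ?thesis using q power_increasing_iff[of "CARD('a)"] by (simp add: mult.commute)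
  qed
  have le: "\<kappa> (Suc k) \<le> Suc (\<kappa> k)" using convex_slope_le[OF 0 1 2 k] .
  have "c k \<le> c (Suc k)" unfolding c_def by (intro card_mono hankel_kernel_mono finite_hankel_kernel)
  then have mono: "\<kappa> k \<le> \<kappa> (Suc k)" using q power_increasing_iff[of "CARD('a)"] unfolding \<kappa> by simp
  show ?thesis
  proof (cases "\<kappa> (Suc k) = Suc (\<kappa> k)")
    case True
    then show ?thesis by (simp add: \<kappa>)
  next
    case False
    then have "\<kappa> (Suc k) = \<kappa> k" using le mono by simp
    moreover from this have "\<kappa> k = 0" using convex_slope_ge[OF 0 1 2 k] by force
    ultimately show ?thesis by (simp add: \<kappa>)
  qed
qed

section \<open>Moments of the kernel sizes\<close>

lemma card_annihilator:
  fixes x :: "'a::{field,finite} poly"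
  assumes x: "x \<noteq> 0" and l: "degree x \<le> l" "l \<le> M"
  shows "card {\<alpha> \<in> polys_below M. \<forall>i. l \<le> i \<and> i < M \<longrightarrow> coeff (\<alpha> * x) i = 0} = CARD('a) ^ l"
  using l(2,1)
proof (induction l rule: inc_induct)
  case base
  have "{\<alpha> \<in> polys_below M. \<forall>i. M \<le> i \<and> i < M \<longrightarrow> coeff (\<alpha> * x) i = 0} = polys_below M" by auto
  then show ?case by (simp add: card_polys_below)
next
  case (step l)
  let ?S = "\<lambda>l. {\<alpha> \<in> polys_below M. \<forall>i. l \<le> i \<and> i < M \<longrightarrow> coeff (\<alpha> * x) i = 0}"
  \<comment> \<open>The product \<open>e * x\<close> is monic of degree \<open>l\<close>. Adding
    multiples of \<open>e\<close> to \<alpha> therefore moves coefficient \<open>l\<close> of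
    \<open>\<alpha> * x\<close> freely and leaves all higher ones alone, so each step down from
    \<open>M\<close> costs one factor \<open>CARD('a)\<close>.\<close>
  define e where "e = monom (1 / lead_coeff x) (l - degree x)"
  have ex: "coeff (e * x) i = (if i < l - degree x then 0 else coeff x (i - (l - degree x)) / lead_coeff x)" for i
    by (auto simp: e_def coeff_monom_mult)
  have e: "e \<in> polys_below M" using step.hyps step.prems by (auto simp: e_def polys_below_def)
  have e1: "coeff (e * x) l = 1" using step.prems x by (simp add: ex)
  have e0: "coeff (e * x) i = 0" if "i > l" for i
    using step.prems that by (simp add: ex coeff_eq_0)
  have "card (?S (Suc l)) = CARD('a) * card {\<alpha> \<in> ?S (Suc l). coeff (\<alpha> * x) l = 0}"
  proof (rule card_eq_card_zero_fibre[where \<tau> = "\<lambda>c \<alpha>. \<alpha> + smult c e"])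
    show "finite (?S (Suc l))" by simp
    show "\<alpha> + smult c e \<in> ?S (Suc l)" if "\<alpha> \<in> ?S (Suc l)" for c \<alpha>
      using that e e0 by (auto simp: add_in_polys_below smult_in_polys_below distrib_right)
    show "inj_on (\<lambda>\<alpha>. \<alpha> + smult c e) (?S (Suc l))" for c by (simp add: inj_on_def)
    show "coeff ((\<alpha> + smult c e) * x) l = coeff (\<alpha> * x) l + c" for c \<alpha>
      by (simp add: distrib_right e1)
  qed
  also have "{\<alpha> \<in> ?S (Suc l). coeff (\<alpha> * x) l = 0} = ?S l"
    using step.hyps by (auto simp: Suc_le_eq) (metis le_neq_implies_less)
  finally show ?case using step.IH step.prems CARD_ge_2[where 'a='a] by simp
qed

text \<open>Double counting of pairs of \<alpha> and a nonzero kernel element: each nonzero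
  \<open>x\<close> in \<open>polys_below k\<close> is annihilated by exactly
  \<open>CARD('a) ^ (k - 1)\<close> of the \<alpha>. The subtracted 1 removes \<open>x = 0\<close>,
  for which this count fails.\<close>

lemma sum_card_hankel_kernel:
  assumes k: "0 < k" "k \<le> M"
  shows "(\<Sum>\<alpha>\<in>polys_below M. real (card (hankel_kernel M (\<alpha> :: 'a::{field,finite} poly) k)) - 1)
    = (real CARD('a) ^ k - 1) * real CARD('a) ^ (k - 1)"
proof -
  let ?R = "\<lambda>(\<alpha> :: 'a poly) x. \<forall>i. k - 1 \<le> i \<and> i < M \<longrightarrow> coeff (\<alpha> * x) i = 0"
  have K: "hankel_kernel M \<alpha> k = insert 0 {x \<in> polys_below k - {0}. ?R \<alpha> x}" for \<alpha> :: "'a poly"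
    using k by (auto simp: hankel_kernel_def)
  have "real (card (hankel_kernel M \<alpha> k)) - 1 = real (card {x \<in> polys_below k - {0}. ?R \<alpha> x})" for \<alpha> :: "'a poly"
    unfolding K by (subst card_insert_disjoint) auto
  then have "(\<Sum>\<alpha>\<in>polys_below M. real (card (hankel_kernel M (\<alpha> :: 'a poly) k)) - 1)
     = real (\<Sum>\<alpha>\<in>polys_below M. card {x \<in> polys_below k - {0}. ?R \<alpha> x})" by simp
  also have "(\<Sum>\<alpha>\<in>polys_below M. card {x \<in> polys_below k - {0}. ?R \<alpha> x})
     = (\<Sum>x \<in> polys_below k - {0::'a poly}. CARD('a) ^ (k - 1))"
  proof (rule sum_multicount_gen)
    show "\<forall>x\<in>polys_below k - {0}. card {\<alpha> \<in> polys_below M. ?R \<alpha> x} = CARD('a) ^ (k - 1)"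
    proof
      fix x :: "'a poly" assume x: "x \<in> polys_below k - {0}"
      then have "degree x \<le> k - 1" using k polys_below_iff_degree[of x "k - 1"] by simp
      with x k show "card {\<alpha> \<in> polys_below M. ?R \<alpha> x} = CARD('a) ^ (k - 1)"
        by (intro card_annihilator) auto
    qed
  qed auto
  also have "\<dots> = (CARD('a) ^ k - 1) * CARD('a) ^ (k - 1)"
    by (simp add: card_Diff_singleton card_polys_below)
  finally show ?thesis by (simp add: of_nat_diff)
qed

text \<open>
  The recursion for exponent 1, where both sides are known, yields the number \<open>A\<close> of \<open>\<alpha>\<close> with
  nontrivial kernel.
\<close>

lemma sum_hankel_kernel_power_Suc:
  fixes s M k :: nat
  defines "q \<equiv> real CARD('a::{field,finite})"
  defines "G \<equiv> \<lambda>k. \<Sum>\<alpha>\<in>polys_below M. real (card (hankel_kernel M (\<alpha> :: 'a poly) k)) ^ s - 1"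
  assumes k: "2 * k \<le> M" "k < M"
  shows "G (Suc k) = q ^ s * G k + (q ^ s - 1) * q ^ (2 * k)"
proof -
  let ?c = "\<lambda>(\<alpha> :: 'a poly) k. real (card (hankel_kernel M \<alpha> k))"
  let ?P = "polys_below M :: 'a poly set"
  \<comment> \<open>The indicator of a nontrivial kernel with \<open>Suc k\<close> columns. In that
    case the kernel has grown by the factor \<open>q\<close>; otherwise both kernels are trivial. As
    \<open>b\<close> does not depend on the exponent \<open>t\<close>, its sum \<open>A\<close>
    found from \<open>t = 1\<close> serves every \<open>t\<close>.\<close>
  define b where "b \<alpha> = (if ?c \<alpha> (Suc k) = 1 then 0 else 1 :: real)" for \<alpha>
  define A where "A = (\<Sum>\<alpha>\<in>?P. b \<alpha>)"
  have q: "q \<ge> 2" using CARD_ge_2[where 'a='a] by (simp add: q_def)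
  have step: "?c \<alpha> (Suc k) ^ t - 1 = q ^ t * (?c \<alpha> k ^ t - 1) + (q ^ t - 1) * b \<alpha>" for t \<alpha>
  proof -
    have "card (hankel_kernel M \<alpha> k) > 0"
      using zero_in_hankel_kernel[of M \<alpha> k] by (auto simp: card_gt_0_iff)
    then have "?c \<alpha> k \<ge> 1" by simp
    then have ne: "q * ?c \<alpha> k \<noteq> 1" using q mult_mono[of 2 q 1 "?c \<alpha> k"] by simp
    from card_hankel_kernel_Suc[OF k(1), of \<alpha>]
    have "?c \<alpha> (Suc k) = q * ?c \<alpha> k \<or> ?c \<alpha> k = 1 \<and> ?c \<alpha> (Suc k) = 1"
      unfolding q_def by (metis of_nat_1 of_nat_mult)
    then show ?thesis
      using ne by (auto simp: b_def power_mult_distrib algebra_simps)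
  qed
  have rec: "(\<Sum>\<alpha>\<in>?P. ?c \<alpha> (Suc k) ^ t - 1) = q ^ t * (\<Sum>\<alpha>\<in>?P. ?c \<alpha> k ^ t - 1) + (q ^ t - 1) * A" for t
    unfolding step by (simp add: sum.distrib sum_distrib_left A_def)
  have "(\<Sum>\<alpha>\<in>?P. ?c \<alpha> (Suc k) - 1) = (q ^ Suc k - 1) * q ^ k"
    using sum_card_hankel_kernel[of "Suc k" M, where 'a='a] k unfolding q_def by simp
  moreover have "q * (\<Sum>\<alpha>\<in>?P. ?c \<alpha> k - 1) = (q ^ k - 1) * q ^ k"
  proof (cases "k = 0")
    case False
    then have "q * q ^ (k - 1) = q ^ k" by (metis power_eq_if)
    then show ?thesis
      using sum_card_hankel_kernel[of k M, where 'a='a] k False unfolding q_def by simp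
  qed simp
  ultimately have "(q ^ Suc k - 1) * q ^ k = (q ^ k - 1) * q ^ k + (q - 1) * A"
    using rec[of 1] by simp
  then have "(q - 1) * A = (q - 1) * q ^ (2 * k)"
    by (simp add: algebra_simps mult_2_right power_add)
  then have "A = q ^ (2 * k)" using q by simp
  then show ?thesis using rec[of s] by (simp add: G_def)
qed

text \<open>The recursion is unrolled from the value 0 at \<open>k = 0\<close>, where all kernels
  are trivial; \<open>q ^ M\<close> restores the 1 subtracted for each \<alpha>. The bound
  \<open>2 * k \<le> Suc M\<close> just admits the square matrix, the case needed later.\<close>

lemma sum_hankel_kernel_power:
  fixes s M k :: nat
  defines "q \<equiv> real CARD('a::{field,finite})"
  assumes k: "2 * k \<le> Suc M" "k \<le> M"
  shows "(\<Sum>\<alpha>\<in>polys_below M. real (card (hankel_kernel M (\<alpha> :: 'a poly) k)) ^ s)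
    = q ^ M + (q ^ s - 1) * (\<Sum>j<k. q ^ (2 * j) * q ^ (s * (k - 1 - j)))"
proof -
  let ?G = "\<lambda>k. \<Sum>\<alpha>\<in>polys_below M. real (card (hankel_kernel M (\<alpha> :: 'a poly) k)) ^ s - 1"
  let ?S = "\<lambda>k. \<Sum>j<k. q ^ (2 * j) * q ^ (s * (k - 1 - j))"
  have "?G k = (q ^ s - 1) * (\<Sum>j<k. q ^ (2 * j) * q ^ (s * (k - 1 - j)))"
    using k
  proof (induction k)
    case (Suc k)
    have "(\<Sum>j<k. q ^ (2 * j) * q ^ (s * (k - j))) = (\<Sum>j<k. q ^ s * (q ^ (2 * j) * q ^ (s * (k - 1 - j))))"
    proof (rule sum.cong)
      fix j assume "j \<in> {..<k}"
      then have "s * (k - j) = s + s * (k - 1 - j)"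
        by (metis Suc_diff_Suc diff_commute diff_Suc_eq_diff_pred lessThan_iff mult_Suc_right)
      then show "q ^ (2 * j) * q ^ (s * (k - j)) = q ^ s * (q ^ (2 * j) * q ^ (s * (k - 1 - j)))"
        by (simp add: power_add)
    qed simp
    then have *: "(\<Sum>j<k. q ^ (2 * j) * q ^ (s * (k - j))) = q ^ s * (\<Sum>j<k. q ^ (2 * j) * q ^ (s * (k - 1 - j)))"
      by (simp add: sum_distrib_left)
    have "?G (Suc k) = q ^ s * ?G k + (q ^ s - 1) * q ^ (2 * k)"
      unfolding q_def by (rule sum_hankel_kernel_power_Suc) (use Suc.prems in auto)
    moreover have "(\<Sum>j<Suc k. q ^ (2 * j) * q ^ (s * (Suc k - 1 - j))) = q ^ s * ?S k + q ^ (2 * k)"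
      using * by simp
    moreover have "?G k = (q ^ s - 1) * ?S k" by (rule Suc.IH) (use Suc.prems in auto)
    ultimately show ?case by (simp only: distrib_left mult.left_commute)
  qed simp
  then show ?thesis by (simp add: sum_subtractf card_polys_below q_def)
qed

subsection \<open>Zeros of the hyperbolic form\<close>

lemma mult_in_polys_below:
  fixes p :: "'a::comm_ring_1 poly"
  assumes "p \<in> polys_below (Suc a)" "r \<in> polys_below (Suc b)"
  shows "p * r \<in> polys_below (Suc (a + b))"
  using assms degree_mult_le[of p r] unfolding polys_below_iff_degree by linarith

text \<open>The kernel of the square Hankel matrix is the radical of the bilinear form taking
  \<open>x\<close> and \<open>y\<close> to coefficient \<open>2 * k\<close> of
  \<open>\<alpha> * x * y\<close>. Only coefficients of \<open>\<alpha> * x\<close> from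
  \<open>k\<close> on meet a coefficient of \<open>y\<close>, and monomials \<open>y\<close> single
  them out.\<close>

lemma hankel_kernel_iff_orthogonal:
  fixes x :: "'a::comm_ring_1 poly"
  assumes "x \<in> polys_below (Suc k)"
  shows "x \<in> hankel_kernel (Suc (2 * k)) \<alpha> (Suc k)
    \<longleftrightarrow> (\<forall>y\<in>polys_below (Suc k). coeff (\<alpha> * x * y) (2 * k) = 0)"
proof
  assume x: "x \<in> hankel_kernel (Suc (2 * k)) \<alpha> (Suc k)"
  show "\<forall>y\<in>polys_below (Suc k). coeff (\<alpha> * x * y) (2 * k) = 0"
  proof
    fix y :: "'a poly" assume y: "y \<in> polys_below (Suc k)"
    have "coeff (\<alpha> * x) i * coeff y (2 * k - i) = 0" if "i \<le> 2 * k" for i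
    proof (cases "k \<le> i")
      case True
      then show ?thesis using x that by (simp add: hankel_kernel_def)
    next
      case False
      then show ?thesis using y by (simp add: polys_below_def)
    qed
    then show "coeff (\<alpha> * x * y) (2 * k) = 0" unfolding coeff_mult by (intro sum.neutral) auto
  qed
next
  assume o: "\<forall>y\<in>polys_below (Suc k). coeff (\<alpha> * x * y) (2 * k) = 0"
  have "coeff (\<alpha> * x) i = 0" if "k \<le> i" "i < Suc (2 * k)" for i
  proof -
    have "monom 1 (2 * k - i) \<in> polys_below (Suc k)" using that by (auto simp: polys_below_def)
    then have "coeff (monom 1 (2 * k - i) * (\<alpha> * x)) (2 * k) = 0" using o by (metis mult.commute)
    moreover have "2 * k - (2 * k - i) = i" using that by simp
    moreover have "\<not> 2 * k < 2 * k - i" by simp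
    ultimately show ?thesis by (simp add: coeff_monom_mult)
  qed
  then show "x \<in> hankel_kernel (Suc (2 * k)) \<alpha> (Suc k)"
    using assms by (simp add: hankel_kernel_def)
qed

text \<open>The pairs of \<alpha> and \<open>p = (u, v)\<close> for which \<alpha> kills
  \<open>w p\<close> are counted in two ways. Fixing \<open>p\<close> detects whether
  \<open>w p = 0\<close>; fixing \<alpha> and \<open>u\<close> leaves a condition linear in
  \<open>v\<close>, which is void exactly when all \<open>u h\<close> lie in the kernel of
  \<alpha>.\<close>

lemma card_hyperbolic_zeros_multiple:
  fixes H :: "'i set" and k :: nat
  assumes H: "finite H"
  defines "X \<equiv> H \<rightarrow>\<^sub>E (polys_below (Suc k) :: 'a::{field,finite} poly set)"
  defines "q \<equiv> real CARD('a)"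
  shows "real (card {p \<in> X \<times> X. (\<Sum>h\<in>H. fst p h * snd p h) = 0}) * q ^ Suc (2 * k)
    = q ^ (Suc k * card H) * (\<Sum>\<alpha>\<in>polys_below (Suc (2 * k)).
        real (card (hankel_kernel (Suc (2 * k)) (\<alpha> :: 'a poly) (Suc k))) ^ card H)"
proof -
  let ?M = "Suc (2 * k)"
  let ?P = "polys_below ?M :: 'a poly set"
  let ?K = "\<lambda>\<alpha>. hankel_kernel ?M \<alpha> (Suc k) :: 'a poly set"
  define w where "w = (\<lambda>p. \<Sum>h\<in>H. fst p h * snd p h :: 'a poly)"
  define N where "N = card {p \<in> X \<times> X. w p = 0}"
  let ?R = "\<lambda>\<alpha> p. coeff (\<alpha> * w p) (2 * k) = 0"
  have finX: "finite X" unfolding X_def by (rule finite_PiE) (use H in auto)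
  have q: "q \<ge> 2" using CARD_ge_2[where 'a='a] by (simp add: q_def)
  have cardX: "real (card X) = q ^ (Suc k * card H)"
    using H by (simp add: X_def card_PiE card_polys_below q_def flip: power_mult power_Suc)
  have XK: "real (card {u \<in> X. \<forall>h\<in>H. u h \<in> ?K \<alpha>}) = real (card (?K \<alpha>)) ^ card H" for \<alpha>
  proof -
    have "{u \<in> X. \<forall>h\<in>H. u h \<in> ?K \<alpha>} = H \<rightarrow>\<^sub>E ?K \<alpha>"
      by (auto simp: X_def hankel_kernel_def PiE_def Pi_def)
    then show ?thesis using H by (simp add: card_PiE)
  qed
  \<comment> \<open>A nonzero \<open>w p\<close> imposes one linear condition on \<alpha>. The
    counts are multiplied by \<open>q\<close> so that no division appears.\<close>
  have for_pair: "q * real (card {\<alpha> \<in> ?P. ?R \<alpha> p}) = (if w p = 0 then q * q ^ ?M else q ^ ?M)"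
    if "p \<in> X \<times> X" for p
  proof (cases "w p = 0")
    case True
    then show ?thesis by (simp add: card_polys_below q_def)
  next
    case False
    have "fst p h * snd p h \<in> polys_below (Suc (k + k))" if "h \<in> H" for h
      using \<open>p \<in> X \<times> X\<close> that by (intro mult_in_polys_below) (auto simp: X_def PiE_def Pi_def)
    then have "degree (w p) \<le> 2 * k"
      unfolding w_def by (intro degree_sum_le H) (simp add: polys_below_iff_degree mult_2)
    then have "card {\<alpha> \<in> ?P. \<forall>i. 2 * k \<le> i \<and> i < ?M \<longrightarrow> coeff (\<alpha> * w p) i = 0} = CARD('a) ^ (2 * k)"
      using False by (intro card_annihilator) auto
    also have "{\<alpha> \<in> ?P. \<forall>i. 2 * k \<le> i \<and> i < ?M \<longrightarrow> coeff (\<alpha> * w p) i = 0} = {\<alpha> \<in> ?P. ?R \<alpha> p}"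
      by (auto simp: less_Suc_eq_le)
    finally show ?thesis using False by (simp add: q_def)
  qed
  have for_u: "q * real (card {v \<in> X. ?R \<alpha> (u, v)})
      = (if \<forall>h\<in>H. u h \<in> ?K \<alpha> then q * real (card X) else real (card X))" if u: "u \<in> X" for u \<alpha>
  proof (cases "\<forall>h\<in>H. u h \<in> ?K \<alpha>")
    case True
    have "?R \<alpha> (u, v)" if v: "v \<in> X" for v
    proof -
      have "coeff (\<alpha> * (u h * v h)) (2 * k) = 0" if "h \<in> H" for h
        using hankel_kernel_iff_orthogonal[of "u h" k \<alpha>] True that u v
        by (auto simp: X_def PiE_def Pi_def mult.assoc)
      then show ?thesis by (simp add: w_def sum_distrib_left coeff_sum)
    qed
    then have "{v \<in> X. ?R \<alpha> (u, v)} = X" by blast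
    then show ?thesis using True by simp
  next
    case False
    then obtain h where h: "h \<in> H" "u h \<notin> ?K \<alpha>" by blast
    moreover from this u have "u h \<in> polys_below (Suc k)" by (auto simp: X_def PiE_def Pi_def)
    ultimately obtain y where y: "y \<in> polys_below (Suc k)" "coeff (\<alpha> * u h * y) (2 * k) \<noteq> 0"
      using hankel_kernel_iff_orthogonal[of "u h" k \<alpha>] by blast
    define b where "b = coeff (\<alpha> * u h * y) (2 * k)"
    \<comment> \<open>Since \<open>b\<close> is the value of the functional on
      \<open>u h * y\<close>, moving the entry of \<open>v\<close> at \<open>h\<close> by
      \<open>smult (c / b) y\<close> changes the value at \<open>w (u, v)\<close> by exactly
      \<open>c\<close>.\<close>
    define \<tau> where "\<tau> c v = v(h := v h + smult (c / b) y)" for c v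
    have "card X = CARD('a) * card {v \<in> X. ?R \<alpha> (u, v)}"
    proof (rule card_eq_card_zero_fibre[where \<tau> = \<tau>])
      show "finite X" by (rule finX)
      show "\<tau> c v \<in> X" if "v \<in> X" for c v
        using that h y by (auto simp: \<tau>_def X_def PiE_def Pi_def extensional_def
            add_in_polys_below smult_in_polys_below)
      show "inj_on (\<tau> c) X" for c
      proof (rule inj_onI)
        fix v v' assume eq: "\<tau> c v = \<tau> c v'"
        show "v = v'"
        proof
          fix i show "v i = v' i" using fun_cong[OF eq, of i] by (cases "i = h") (auto simp: \<tau>_def)
        qed
      qed
      show "coeff (\<alpha> * w (u, \<tau> c v)) (2 * k) = coeff (\<alpha> * w (u, v)) (2 * k) + c" for c v
      proof -
        have "w (u, \<tau> c v) = w (u, v) + smult (c / b) (u h * y)"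
          using h by (simp add: w_def \<tau>_def sum.remove[OF H, of h] algebra_simps)
        then show ?thesis using y(2) by (simp add: distrib_left b_def mult.assoc)
      qed
    qed
    then show ?thesis unfolding if_not_P[OF False] by (simp add: q_def)
  qed
  have for_alpha: "q * real (card {p \<in> X \<times> X. ?R \<alpha> p})
      = real (card X) * (real (card X) + (q - 1) * real (card (?K \<alpha>)) ^ card H)" for \<alpha>
  proof -
    have "{p \<in> X \<times> X. ?R \<alpha> p} = (SIGMA u:X. {v \<in> X. ?R \<alpha> (u, v)})" by auto
    then have "q * real (card {p \<in> X \<times> X. ?R \<alpha> p}) = (\<Sum>u\<in>X. q * real (card {v \<in> X. ?R \<alpha> (u, v)}))"
      using finX by (simp add: sum_distrib_left)
    also have "\<dots> = (\<Sum>u\<in>X. real (card X) + (if \<forall>h\<in>H. u h \<in> ?K \<alpha> then (q - 1) * real (card X) else 0))"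
      by (rule sum.cong[OF refl]) (simp only: for_u, simp add: left_diff_distrib)
    also have "\<dots> = real (card X) * real (card X)
        + real (card {u \<in> X. \<forall>h\<in>H. u h \<in> ?K \<alpha>}) * ((q - 1) * real (card X))"
      using finX by (simp add: sum.distrib flip: sum.inter_filter)
    finally show ?thesis unfolding XK by (simp add: algebra_simps)
  qed
  have "(\<Sum>\<alpha>\<in>?P. card {p \<in> X \<times> X. ?R \<alpha> p}) = (\<Sum>p\<in>X \<times> X. card {\<alpha> \<in> ?P. ?R \<alpha> p})"
    by (rule sum_multicount_gen) (use finX in auto)
  then have "q * real (\<Sum>\<alpha>\<in>?P. card {p \<in> X \<times> X. ?R \<alpha> p}) = q * real (\<Sum>p\<in>X \<times> X. card {\<alpha> \<in> ?P. ?R \<alpha> p})"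
    by simp
  then have "(\<Sum>\<alpha>\<in>?P. q * real (card {p \<in> X \<times> X. ?R \<alpha> p})) = (\<Sum>p\<in>X \<times> X. q * real (card {\<alpha> \<in> ?P. ?R \<alpha> p}))"
    by (simp add: sum_distrib_left)
  moreover have "(\<Sum>\<alpha>\<in>?P. q * real (card {p \<in> X \<times> X. ?R \<alpha> p}))
      = real (card X) * (real (card X) * q ^ ?M + (q - 1) * (\<Sum>\<alpha>\<in>?P. real (card (?K \<alpha>)) ^ card H))"
    unfolding for_alpha by (simp add: sum.distrib sum_distrib_left[symmetric] card_polys_below q_def mult.commute)
  moreover have "(\<Sum>p\<in>X \<times> X. q * real (card {\<alpha> \<in> ?P. ?R \<alpha> p}))
      = (\<Sum>p\<in>X \<times> X. q ^ ?M + (if w p = 0 then (q - 1) * q ^ ?M else 0))"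
    by (rule sum.cong[OF refl]) (simp only: for_pair, simp add: left_diff_distrib)
  moreover have "\<dots> = real (card X) * real (card X) * q ^ ?M + real N * ((q - 1) * q ^ ?M)"
    using finX by (simp add: sum.distrib card_cartesian_product N_def flip: sum.inter_filter)
  \<comment> \<open>The main term, \<open>q ^ ?M\<close> times the square of \<open>card X\<close>,
    occurs in both counts and cancels; what remains carries the factor \<open>q - 1\<close>.\<close>
  ultimately have "(q - 1) * (real N * q ^ ?M)
      = (q - 1) * (real (card X) * (\<Sum>\<alpha>\<in>?P. real (card (?K \<alpha>)) ^ card H))"
    by (simp add: algebra_simps)
  then have "real N * q ^ ?M = real (card X) * (\<Sum>\<alpha>\<in>?P. real (card (?K \<alpha>)) ^ card H)"
    using q by simp
  then show ?thesis by (simp add: N_def w_def cardX)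
qed

subsection \<open>Primitive zeros\<close>

definition zeros_below :: "'a::{field,finite} ^'n ^'n \<Rightarrow> nat \<Rightarrow> ('a poly ^'n) set" where
  "zeros_below A k = {x. (\<forall>i. x $ i \<in> polys_below k) \<and> qf_poly A x = 0}"

lemma finite_vec_components:
  assumes "finite S"
  shows "finite {x :: 'b ^'n. \<forall>i. x $ i \<in> S}"
proof (rule finite_surj)
  show "finite ((UNIV :: 'n set) \<rightarrow>\<^sub>E S)" by (rule finite_PiE) (use assms in auto)
  show "{x :: 'b ^'n. \<forall>i. x $ i \<in> S} \<subseteq> vec_lambda ` ((UNIV :: 'n set) \<rightarrow>\<^sub>E S)"
    by (rule subsetI, rule image_eqI[where x = "vec_nth _"]) (auto simp: vec_lambda_eta)
qed

lemma finite_zeros_below [simp]: "finite (zeros_below A k)"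
  by (rule finite_subset[OF _ finite_vec_components[of "polys_below k"]]) (auto simp: zeros_below_def)

lemma qf_poly_scale: "qf_poly A (g *s x) = g\<^sup>2 * qf_poly A x"
  by (simp add: qf_poly_def sum_distrib_left power2_eq_square mult_ac)

text \<open>The ideal \<open>I\<close> generated by the entries is principal: a nonzero element of
  least degree divides every member, since the remainder lies in \<open>I\<close> and has smaller
  degree. Scaling makes this gcd monic.\<close>

lemma poly_vec_bezout:
  fixes x :: "'a::field poly ^'n"
  assumes "x \<noteq> 0"
  obtains g c where "g = (\<Sum>i\<in>UNIV. c i * x $ i)" "lead_coeff g = 1" "\<And>i. g dvd x $ i"
proof -
  define I where "I = range (\<lambda>c. \<Sum>i\<in>UNIV. c i * x $ i)"
  have I: "r * a - s * b \<in> I" if "a \<in> I" "b \<in> I" for r s a b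
  proof -
    from that obtain c e where "a = (\<Sum>i\<in>UNIV. c i * x $ i)" "b = (\<Sum>i\<in>UNIV. e i * x $ i)"
      by (auto simp: I_def)
    then have "r * a - s * b = (\<Sum>i\<in>UNIV. (r * c i - s * e i) * x $ i)"
      by (simp add: sum_distrib_left sum_subtractf left_diff_distrib mult.assoc)
    then show ?thesis by (auto simp: I_def)
  qed
  have x: "x $ i \<in> I" for i
  proof -
    have "x $ i = (\<Sum>j\<in>UNIV. (if j = i then 1 else 0) * x $ j)"
      by (simp add: if_distrib if_distribR cong: if_cong)
    then show ?thesis
      unfolding I_def by (intro image_eqI[where x = "\<lambda>j. if j = i then 1 else 0"]) auto
  qed
  obtain i where "x $ i \<noteq> 0" using assms by (auto simp: vec_eq_iff)
  then have "\<exists>g. g \<in> I \<and> g \<noteq> 0" using x by blast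
  from ex_has_least_nat[of "\<lambda>g. g \<in> I \<and> g \<noteq> 0" _ degree] this
  obtain g where g: "g \<in> I" "g \<noteq> 0" and least: "\<And>h. h \<in> I \<Longrightarrow> h \<noteq> 0 \<Longrightarrow> degree g \<le> degree h"
    by metis
  have dvd: "g dvd a" if "a \<in> I" for a
  proof -
    have "1 * a - (a div g) * g \<in> I" using that g by (intro I)
    then have "a mod g \<in> I" by (simp add: minus_div_mult_eq_mod)
    then have "a mod g = 0" using least[of "a mod g"] degree_mod_less[OF g(2), of a]
      by (cases "a mod g = 0") auto
    then show ?thesis by (simp add: mod_eq_0_iff_dvd)
  qed
  define h where "h = smult (1 / lead_coeff g) g"
  have "[:1 / lead_coeff g:] * g - 0 * g \<in> I" using g by (intro I)
  then have "h \<in> I" by (simp add: h_def)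
  then obtain c where "h = (\<Sum>i\<in>UNIV. c i * x $ i)" by (auto simp: I_def)
  moreover have "lead_coeff h = 1" using g by (simp add: h_def)
  moreover have "h dvd x $ i" for i using dvd[OF x] g by (simp add: h_def smult_dvd)
  ultimately show thesis by (rule that)
qed

definition primitive_vec :: "'a::field poly ^'n \<Rightarrow> bool" where
  "primitive_vec x \<longleftrightarrow> (\<forall>d. (\<forall>i. d dvd x $ i) \<longrightarrow> is_unit d)"

lemma primitive_vec_nonzero: "primitive_vec (x :: 'a::field poly ^'n) \<Longrightarrow> x \<noteq> 0"
proof
  assume "primitive_vec x" "x = 0"
  then have "is_unit (0 :: 'a poly)" unfolding primitive_vec_def by (metis dvd_0_right zero_index)
  then show False by simp
qed

lemma primitive_vec_bezout:
  assumes "primitive_vec x"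
  obtains c where "(\<Sum>i\<in>UNIV. c i * x $ i) = 1"
proof -
  obtain g c where g: "g = (\<Sum>i\<in>UNIV. c i * x $ i)" "lead_coeff g = 1" "\<And>i. g dvd x $ i"
    by (rule poly_vec_bezout[OF primitive_vec_nonzero[OF assms]]) blast
  then have "is_unit g" using assms by (simp add: primitive_vec_def)
  then obtain a where "g = [:a:]" by (rule is_unit_polyE)
  then have "g = 1" using g(2) by (simp add: one_pCons)
  then show thesis using g(1) by (intro that[of c]) simp
qed

text \<open>Uniqueness of the factorisation into a monic polynomial and a primitive vector.
  Multiplying a Bezout relation for \<open>x\<close> by \<open>g\<close> shows that \<open>h\<close>
  divides \<open>g\<close>; by symmetry the two are associated, and being monic they agree.\<close>

lemma primitive_vec_monic_cancel:
  fixes x y :: "'a::field poly ^'n"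
  assumes p: "primitive_vec x" "primitive_vec y" and eq: "g *s x = h *s y"
    and monic: "lead_coeff g = 1" "lead_coeff h = 1"
  shows "g = h \<and> x = y"
proof -
  have dvd: "h dvd g" if p': "primitive_vec x" and eq': "g *s x = h *s y" for g h and x y :: "'a poly ^'n"
  proof -
    obtain c where c: "(\<Sum>i\<in>UNIV. c i * x $ i) = 1" by (rule primitive_vec_bezout[OF p'])
    have "g * x $ i = h * y $ i" for i using eq' by (metis vector_smult_component)
    then have "h dvd (\<Sum>i\<in>UNIV. c i * (g * x $ i))" by (intro dvd_sum) simp
    also have "(\<Sum>i\<in>UNIV. c i * (g * x $ i)) = g * (\<Sum>i\<in>UNIV. c i * x $ i)"
      by (simp add: sum_distrib_left mult.left_commute)
    finally show ?thesis by (simp add: c)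
  qed
  have "g = h"
  proof -
    obtain r where r: "g = h * r" using dvd[OF p(1) eq] by (rule dvdE)
    have "h * r dvd h * 1" using dvd[OF p(2) eq[symmetric]] by (simp add: r)
    moreover have "h \<noteq> 0" using monic by auto
    ultimately have "is_unit r" by (simp only: dvd_mult_cancel_left) simp
    then obtain a where "r = [:a:]" by (rule is_unit_polyE)
    moreover have "lead_coeff r = 1" using monic by (simp add: r lead_coeff_mult)
    ultimately show ?thesis by (simp add: r one_pCons)
  qed
  moreover from this have "x = y"
    using eq monic by (auto simp: vec_eq_iff)
  ultimately show ?thesis by blast
qed

section \<open>Zeros as monic multiples of primitive zeros\<close>

definition monic_polys :: "nat \<Rightarrow> 'a::{zero_neq_one,comm_monoid_add} poly set" where
  "monic_polys m = {g. lead_coeff g = 1 \<and> degree g \<le> m}"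

lemma finite_card_monic_polys:
  "finite (monic_polys m :: 'a::{field,finite} poly set) \<and>
   card (monic_polys m :: 'a poly set) = (\<Sum>l\<le>m. CARD('a) ^ l)"
proof -
  let ?f = "\<lambda>d p. p + monom (1 :: 'a) d"
  have "monic_polys m = (\<Union>d\<le>m. ?f d ` polys_below d)"
  proof (intro equalityI subsetI)
    fix g :: "'a poly" assume g: "g \<in> monic_polys m"
    then have "g - monom 1 (degree g) \<in> polys_below (degree g)"
      by (auto simp: monic_polys_def polys_below_def coeff_eq_0)
    then have "g \<in> ?f (degree g) ` polys_below (degree g)"
      by (rule rev_image_eqI) simp
    then show "g \<in> (\<Union>d\<le>m. ?f d ` polys_below d)" using g by (auto simp: monic_polys_def)
  next
    fix g :: "'a poly" assume "g \<in> (\<Union>d\<le>m. ?f d ` polys_below d)"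
    then obtain d p where d: "d \<le> m" "p \<in> polys_below d" "g = ?f d p" by auto
    then have "coeff g d = 1" "degree g \<le> d"
      by (auto simp: polys_below_def intro!: degree_le)
    moreover from this have "degree g = d" by (intro antisym le_degree) auto
    ultimately show "g \<in> monic_polys m" using d by (simp add: monic_polys_def)
  qed
  moreover have "card (\<Union>d\<le>m. ?f d ` polys_below d) = (\<Sum>d\<le>m. card (?f d ` polys_below d))"
  proof (rule card_UN_disjoint)
    have "\<And>d p. p \<in> polys_below d \<Longrightarrow> degree (?f d p) = d"
      by (intro antisym degree_le le_degree) (auto simp: polys_below_def)
    then show "\<forall>i\<in>{..m}. \<forall>j\<in>{..m}. i \<noteq> j \<longrightarrow> ?f i ` polys_below i \<inter> ?f j ` polys_below j = {}"
      by (metis (no_types, lifting) Int_emptyI imageE)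
  qed auto
  moreover have "card (?f d ` polys_below d) = CARD('a) ^ d" for d
    by (subst card_image) (auto simp: inj_on_def card_polys_below)
  ultimately show ?thesis by simp
qed

text \<open>The entry attaining the maximal degree can be taken nonzero. This needs an argument only
  for \<open>j = 0\<close>, since the zero polynomial also has degree 0; it is what makes degrees
  add up under scaling by a monic polynomial.\<close>

lemma mor_vectors_iff:
  "x \<in> mor_vectors A j \<longleftrightarrow> primitive_vec x \<and> qf_poly A x = 0
     \<and> (\<forall>i. degree (x $ i) \<le> j) \<and> (\<exists>i. x $ i \<noteq> 0 \<and> degree (x $ i) = j)"
proof -
  let ?R = "range (\<lambda>i. degree (x $ i))"
  have "(Max ?R = j) \<longleftrightarrow> (\<forall>i. degree (x $ i) \<le> j) \<and> (\<exists>i. degree (x $ i) = j)"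
    using Max_eq_iff[of ?R j] by auto
  moreover have "\<exists>i. x $ i \<noteq> 0 \<and> degree (x $ i) = j"
    if nz: "x \<noteq> 0" and le: "\<forall>i. degree (x $ i) \<le> j" and ex: "\<exists>i. degree (x $ i) = j"
  proof (cases "j = 0")
    case True
    obtain i where "x $ i \<noteq> 0" using nz by (auto simp: vec_eq_iff)
    then show ?thesis using le True by auto
  qed (use ex in force)
  ultimately show ?thesis
    using primitive_vec_nonzero[of x] unfolding mor_vectors_def primitive_vec_def[symmetric] by blast
qed

lemma finite_mor_vectors [simp]: "finite (mor_vectors A j)"
  by (rule finite_subset[OF _ finite_vec_components[of "polys_below (Suc j)"]])
     (auto simp: mor_vectors_iff polys_below_iff_degree)

text \<open>The summand 1 is the zero vector. Any other zero is \<open>g *s x\<close> for a unique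
  monic \<open>g\<close> and primitive \<open>x\<close>, and if \<open>x\<close> has degree
  \<open>j\<close> the entries lie below \<open>k\<close> exactly when \<open>g\<close> has degree
  at most \<open>k - 1 - j\<close>.\<close>

lemma card_zeros_below:
  fixes A :: "'a::{field,finite} ^'n ^'n"
  shows "card (zeros_below A k) = 1 + (\<Sum>j<k. card (mor_vectors A j) * (\<Sum>l\<le>k - 1 - j. CARD('a) ^ l))"
proof -
  define T where "T = (SIGMA j:{..<k}. mor_vectors A j \<times> (monic_polys (k - 1 - j) :: 'a poly set))"
  define f where "f = (\<lambda>(j :: nat, x :: 'a poly ^'n, g :: 'a poly). g *s x)"
  have inj: "inj_on f T"
  proof (rule inj_onI)
    fix s t assume "s \<in> T" "t \<in> T" and eq: "f s = f t"
    then obtain j x g j' x' g' where st: "s = (j, x, g)" "t = (j', x', g')"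
      and x: "x \<in> mor_vectors A j" "x' \<in> mor_vectors A j'"
      and g: "lead_coeff g = 1" "lead_coeff g' = 1"
      by (auto simp: T_def monic_polys_def)
    then have "g = g' \<and> x = x'"
      using eq by (intro primitive_vec_monic_cancel) (auto simp: f_def mor_vectors_iff)
    moreover from this have "j = j'" using x unfolding mor_vectors_iff by (metis le_antisym)
    ultimately show "s = t" by (simp add: st)
  qed
  have "f ` T = zeros_below A k - {0}"
  proof (intro equalityI subsetI)
    fix z assume "z \<in> f ` T"
    then obtain j x g where j: "j < k" and x: "x \<in> mor_vectors A j"
      and g: "lead_coeff g = 1" "degree g \<le> k - 1 - j" and z: "z = g *s x"
      by (auto simp: T_def f_def monic_polys_def)
    have "g * x $ i \<in> polys_below k" for i
    proof -
      have "degree (g * x $ i) \<le> degree g + degree (x $ i)" by (rule degree_mult_le)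
      also have "degree (x $ i) \<le> j" using x by (simp add: mor_vectors_iff)
      also have "degree g + j \<le> k - 1" using g(2) j by simp
      finally show ?thesis using j polys_below_iff_degree[of "g * x $ i" "k - 1"] by simp
    qed
    moreover have "g *s x \<noteq> 0" using x g(1) by (auto simp: mor_vectors_iff vec_eq_iff)
    ultimately show "z \<in> zeros_below A k - {0}"
      using x by (simp add: z zeros_below_def mor_vectors_iff qf_poly_scale)
  next
    fix z assume z: "z \<in> zeros_below A k - {0}"
    then obtain g c where g: "g = (\<Sum>i\<in>UNIV. c i * z $ i)" "lead_coeff g = 1" "\<And>i. g dvd z $ i"
      using poly_vec_bezout[of z] by auto
    define x where "x = (\<chi> i. z $ i div g)"
    have zx: "z = g *s x" using g(3) by (simp add: x_def vec_eq_iff)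
    have g0: "g \<noteq> 0" using g(2) by auto
    have "primitive_vec x"
      unfolding primitive_vec_def
    proof (intro allI impI)
      fix d assume "\<forall>i. d dvd x $ i"
      \<comment> \<open>A common divisor \<open>d\<close> of the cofactors makes
        \<open>d * g\<close> divide every \<open>z $ i\<close>, hence also their Bezout combination
        \<open>g\<close>.\<close>
      then have "d * g dvd z $ i" for i by (simp add: zx mult.commute[of d] mult_dvd_mono)
      then have "d * g dvd (\<Sum>i\<in>UNIV. c i * z $ i)" by (intro dvd_sum) simp
      then have "d * g dvd 1 * g" by (simp flip: g(1))
      then show "is_unit d" using g0 by (simp only: dvd_mult_cancel_right) simp
    qed
    moreover have "qf_poly A x = 0" using z g0 by (simp add: zeros_below_def zx qf_poly_scale)
    moreover define j where "j = Max (range (\<lambda>i. degree (x $ i)))"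
    ultimately have x: "x \<in> mor_vectors A j" by (simp add: mor_vectors_def primitive_vec_def)
    then obtain i where i: "x $ i \<noteq> 0" "degree (x $ i) = j" unfolding mor_vectors_iff by blast
    then have "degree (z $ i) = degree g + j" "z $ i \<noteq> 0" using g0 by (auto simp: zx degree_mult_eq)
    moreover have "z $ i \<in> polys_below k" using z by (simp add: zeros_below_def)
    ultimately have "degree g + j < k"
      unfolding polys_below_def by (metis (mono_tags, lifting) leading_coeff_0_iff mem_Collect_eq not_le)
    then have "(j, x, g) \<in> T" using x g(2) by (simp add: T_def monic_polys_def)
    then show "z \<in> f ` T" by (rule rev_image_eqI) (simp add: f_def zx)
  qed
  then have "card (zeros_below A k - {0}) = card T" using card_image[OF inj] by simp
  moreover have "0 \<in> zeros_below A k" by (simp add: zeros_below_def qf_poly_def)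
  ultimately have "card (zeros_below A k) = 1 + card T"
    by (metis card_Suc_Diff1 finite_zeros_below plus_1_eq_Suc)
  also have "card T = (\<Sum>j<k. card (mor_vectors A j) * (\<Sum>l\<le>k - 1 - j. CARD('a) ^ l))"
    by (simp add: T_def finite_card_monic_polys card_cartesian_product)
  finally show ?thesis .
qed

text \<open>The geometric weights have generating function 1/((1 - T)(1 - qT)), so the inversion
  applies (1 - T)(1 - qT) to the zero counts. The relation \<open>rec\<close> removes the factor 1 -
  qT; one more difference isolates a single degree and cancels the constant
  \<open>1 - q\<close>.\<close>

lemma card_mor_vectors:
  fixes A :: "'a::{field,finite} ^'n ^'n"
  defines "q \<equiv> real CARD('a)"
  shows "real (card (mor_vectors A (Suc k))) = real (card (zeros_below A (Suc (Suc k))))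
    - (q + 1) * real (card (zeros_below A (Suc k))) + q * real (card (zeros_below A k))"
proof -
  let ?m = "\<lambda>j. real (card (mor_vectors A j))" and ?z = "\<lambda>k. real (card (zeros_below A k))"
  have rec: "?z (Suc k) = q * ?z k + (1 - q) + (\<Sum>j<Suc k. ?m j)" for k
  proof -
    have geo: "(\<Sum>l\<le>k - j. q ^ l) = 1 + q * (\<Sum>l\<le>k - 1 - j. q ^ l)" if "j < k" for j
    proof -
      define d where "d = k - 1 - j"
      have "k - j = Suc d" using that by (simp add: d_def)
      then have "(\<Sum>l\<le>k - j. q ^ l) = 1 + q * (\<Sum>l\<le>d. q ^ l)"
        by (simp only: sum.atMost_Suc_shift sum_distrib_left) simp
      then show ?thesis by (simp only: d_def)
    qed
    have "(\<Sum>j<k. ?m j * (\<Sum>l\<le>k - j. q ^ l)) = (\<Sum>j<k. ?m j * (1 + q * (\<Sum>l\<le>k - 1 - j. q ^ l)))"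
      by (rule sum.cong[OF refl]) (simp only: geo lessThan_iff)
    also have "\<dots> = (\<Sum>j<k. ?m j) + q * (\<Sum>j<k. ?m j * (\<Sum>l\<le>k - 1 - j. q ^ l))"
      by (simp add: distrib_left sum.distrib sum_distrib_left mult.left_commute)
    finally show ?thesis
      unfolding card_zeros_below by (simp add: q_def) (simp add: algebra_simps)
  qed
  have "(\<Sum>j<Suc (Suc k). ?m j) = (\<Sum>j<Suc k. ?m j) + ?m (Suc k)" by simp
  then show ?thesis using rec[of "Suc k"] rec[of k] unfolding distrib_right by linarith
qed

subsection \<open>Congruence of symmetric matrices over a finite field\<close>

definition congruent_mat :: "'a::field ^'n ^'n \<Rightarrow> 'a ^'n ^'n \<Rightarrow> bool" where
  "congruent_mat A B \<longleftrightarrow> (\<exists>S. invertible S \<and> B = transpose S ** A ** S)"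

lemma congruent_mat_refl: "congruent_mat A A"
  unfolding congruent_mat_def
  by (rule exI[of _ "mat 1"]) (auto simp: invertible_def)

lemma congruent_mat_trans:
  assumes "congruent_mat A B" "congruent_mat B C"
  shows "congruent_mat A C"
proof -
  obtain S T where "invertible S" "B = transpose S ** A ** S" "invertible T" "C = transpose T ** B ** T"
    using assms by (auto simp: congruent_mat_def)
  then have "invertible (S ** T)" "C = transpose (S ** T) ** A ** (S ** T)"
    by (auto simp: invertible_mult matrix_transpose_mul matrix_mul_assoc)
  then show ?thesis unfolding congruent_mat_def by blast
qed

lemma congruent_mat_symmetric:
  assumes "congruent_mat A B" "transpose A = A"
  shows "transpose B = B"
proof -
  obtain S where "B = transpose S ** A ** S" using assms(1) by (auto simp: congruent_mat_def)
  then show ?thesis by (simp add: matrix_transpose_mul matrix_mul_assoc assms(2))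
qed

lemma congruent_mat_det:
  assumes "congruent_mat A B"
  obtains s where "s \<noteq> 0" "det B = s\<^sup>2 * det A"
proof -
  obtain S where "invertible S" "B = transpose S ** A ** S" using assms by (auto simp: congruent_mat_def)
  then have "det S \<noteq> 0" "det B = (det S)\<^sup>2 * det A"
    by (auto simp: invertible_det_nz det_mul det_transpose power2_eq_square)
  then show thesis by (rule that)
qed

section \<open>Scalar linear substitutions in vectors of polynomials\<close>

definition poly_mat_apply :: "'a::comm_ring_1 ^'n ^'n \<Rightarrow> 'a poly ^'n \<Rightarrow> 'a poly ^'n" where
  "poly_mat_apply S x = (\<chi> i. \<Sum>j\<in>UNIV. smult (S $ i $ j) (x $ j))"

lemma smult_sum_right: "smult c (\<Sum>i\<in>I. f i) = (\<Sum>i\<in>I. smult c (f i))"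
  by (induction I rule: infinite_finite_induct) (auto simp: smult_add_right)

lemma sum_mult_delta:
  fixes f :: "'n::finite \<Rightarrow> 'a::semiring_0"
  shows "(\<Sum>k\<in>UNIV. f k * (if k = b then g k else 0)) = f b * g b"
    and "(\<Sum>k\<in>UNIV. f k * (if b = k then g k else 0)) = f b * g b"
    and "(\<Sum>k\<in>UNIV. (if k = b then g k else 0) * f k) = g b * f b"
    and "(\<Sum>k\<in>UNIV. (if b = k then g k else 0) * f k) = g b * f b"
proof -
  have "f k * (if k = b then g k else 0) = (if k = b then f b * g b else 0)"
    "(if k = b then g k else 0) * f k = (if k = b then g b * f b else 0)" for k
    by simp_all
  then show "(\<Sum>k\<in>UNIV. f k * (if k = b then g k else 0)) = f b * g b"
    and "(\<Sum>k\<in>UNIV. f k * (if b = k then g k else 0)) = f b * g b"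
    and "(\<Sum>k\<in>UNIV. (if k = b then g k else 0) * f k) = g b * f b"
    and "(\<Sum>k\<in>UNIV. (if b = k then g k else 0) * f k) = g b * f b"
    by (simp_all add: eq_commute[of b])
qed

lemma poly_mat_apply_mult: "poly_mat_apply (S ** T) x = poly_mat_apply S (poly_mat_apply T x)"
proof -
  have "(\<Sum>j\<in>UNIV. smult (\<Sum>k\<in>UNIV. S $ i $ k * T $ k $ j) (x $ j))
     = (\<Sum>k\<in>UNIV. smult (S $ i $ k) (\<Sum>j\<in>UNIV. smult (T $ k $ j) (x $ j)))" for i
    unfolding smult_sum smult_sum_right smult_smult by (rule sum.swap)
  then show ?thesis by (simp add: poly_mat_apply_def matrix_matrix_mult_def)
qed

lemma poly_mat_apply_1: "poly_mat_apply (mat 1) x = x"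
  by (simp add: poly_mat_apply_def mat_def vec_eq_iff if_distrib if_distribR cong: if_cong)

lemma qf_poly_eq: "qf_poly A x = (\<Sum>i\<in>UNIV. x $ i * poly_mat_apply A x $ i)"
  by (simp add: qf_poly_def poly_mat_apply_def sum_distrib_left mult.commute)

lemma qf_poly_congruent:
  "qf_poly (transpose S ** A ** S) x = qf_poly A (poly_mat_apply S x)"
proof -
  define y where "y = poly_mat_apply A (poly_mat_apply S x)"
  have "qf_poly (transpose S ** A ** S) x = (\<Sum>i\<in>UNIV. x $ i * poly_mat_apply (transpose S) y $ i)"
    by (simp add: qf_poly_eq poly_mat_apply_mult y_def)
  also have "\<dots> = (\<Sum>i\<in>UNIV. \<Sum>j\<in>UNIV. smult (S $ j $ i) (x $ i) * y $ j)"
    by (simp add: poly_mat_apply_def transpose_def sum_distrib_left)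
  also have "\<dots> = (\<Sum>j\<in>UNIV. \<Sum>i\<in>UNIV. smult (S $ j $ i) (x $ i) * y $ j)" by (rule sum.swap)
  also have "\<dots> = qf_poly A (poly_mat_apply S x)"
    by (simp add: qf_poly_eq y_def[symmetric] sum_distrib_right) (simp add: poly_mat_apply_def sum_distrib_right)
  finally show ?thesis .
qed

lemma poly_mat_apply_below:
  assumes "\<forall>i. x $ i \<in> polys_below k"
  shows "poly_mat_apply S x $ i \<in> polys_below k"
proof -
  have "coeff (x $ j) l = 0" if "k \<le> l" for j l using assms that unfolding polys_below_def by blast
  then show ?thesis by (simp add: poly_mat_apply_def polys_below_def coeff_sum)
qed

text \<open>An invertible substitution with scalar entries preserves the degree bound in both
  directions, so it matches the zeros of the two forms.\<close>

lemma card_zeros_below_congruent: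
  assumes "congruent_mat A B"
  shows "card (zeros_below B k) = card (zeros_below A k)"
proof -
  obtain S T where S: "B = transpose S ** A ** S" and ST: "S ** T = mat 1" "T ** S = mat 1"
    using assms by (auto simp: congruent_mat_def invertible_def)
  have ST': "poly_mat_apply S (poly_mat_apply T x) = x" "poly_mat_apply T (poly_mat_apply S x) = x" for x
    by (simp_all flip: poly_mat_apply_mult add: ST poly_mat_apply_1)
  have "bij_betw (poly_mat_apply S) (zeros_below B k) (zeros_below A k)"
    by (rule bij_betw_byWitness[where f' = "poly_mat_apply T"])
       (auto simp: zeros_below_def S qf_poly_congruent ST' poly_mat_apply_below)
  then show ?thesis by (rule bij_betw_same_card)
qed

text \<open>Congruence by the base change \<open>e\<^sub>j \<mapsto> e\<^sub>j + w\<^sub>j e\<^sub>i\<close>.\<close>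

lemma congruent_mat_shear:
  fixes A :: "'a::field ^'n ^'n"
  assumes w: "1 + w i \<noteq> 0"
  shows "congruent_mat A (\<chi> j k. A $ j $ k + w j * A $ i $ k + w k * A $ j $ i + w j * w k * A $ i $ i)"
proof -
  define E :: "('n \<Rightarrow> 'a) \<Rightarrow> 'a ^'n ^'n"
    where "E w = (\<chi> k l. (if k = l then 1 else 0) + (if k = i then w l else 0))" for w
  have mult: "(M ** E w) $ a $ b = M $ a $ b + M $ a $ i * w b" for M w a b
    by (simp add: E_def matrix_matrix_mult_def distrib_left sum.distrib sum_mult_delta)
  \<comment> \<open>\<open>E w\<close> is the identity with \<open>w\<close> added to row
    \<open>i\<close>; its inverse has the same shape, with \<open>w'\<close> in place of
    \<open>w\<close>.\<close>
  define w' where "w' l = - w l / (1 + w i)" for l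
  have "w b + w' b + w i * w' b = 0" for b
  proof -
    have "w b + w' b + w i * w' b = w b + (1 + w i) * w' b" by (simp add: algebra_simps)
    then show ?thesis using w by (simp add: w'_def)
  qed
  then have "(E w ** E w') $ a $ b = mat 1 $ a $ b" for a b
    unfolding mult by (auto simp: E_def mat_def algebra_simps)
  then have "invertible (E w)" unfolding invertible_right_inverse by (metis vec_eq_iff)
  moreover have "(transpose (E w) ** A ** E w) $ j $ k
      = A $ j $ k + w j * A $ i $ k + w k * A $ j $ i + w j * w k * A $ i $ i" for j k
  proof -
    have tr: "(transpose (E w) ** A) $ a $ b = A $ a $ b + w a * A $ i $ b" for a b
      by (simp add: E_def matrix_matrix_mult_def transpose_def distrib_right sum.distrib sum_mult_delta)
    show ?thesis unfolding mult tr by (simp add: algebra_simps)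
  qed
  ultimately show ?thesis
    unfolding congruent_mat_def by (intro exI[of _ "E w"]) (simp add: vec_eq_iff)
qed

section \<open>Diagonalisation\<close>

definition diag_mat :: "('n \<Rightarrow> 'a::zero) \<Rightarrow> 'a ^'n ^'n" where
  "diag_mat a = (\<chi> i j. if i = j then a i else 0)"

lemma det_diag_mat: "det (diag_mat a :: 'a::comm_ring_1 ^'n ^'n) = prod a UNIV"
  by (subst det_diagonal) (auto simp: diag_mat_def)

text \<open>Symmetric Gaussian elimination: \<open>D\<close> collects the indices whose rows are
  already cleared. If the pivot at \<open>i\<close> vanishes although the row does not, a
  preliminary shear makes it nonzero, which is where \<open>2 \<noteq> 0\<close> enters.\<close>

lemma congruent_diagonal_on:
  fixes A :: "'a::field ^'n ^'n"
  assumes two: "(2 :: 'a) \<noteq> 0" and sym: "transpose A = A"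
  shows "\<exists>B. congruent_mat A B \<and> (\<forall>i\<in>D. \<forall>j. j \<noteq> i \<longrightarrow> B $ i $ j = 0)"
  using finite[of D]
proof (induction D)
  case empty
  show ?case using congruent_mat_refl by auto
next
  case (insert i D)
  then obtain B where AB: "congruent_mat A B" and D: "\<And>l j. l \<in> D \<Longrightarrow> j \<noteq> l \<Longrightarrow> B $ l $ j = 0"
    by blast
  have symm: "C $ j $ l = C $ l $ j" if "congruent_mat A C" for C j l
    using congruent_mat_symmetric[OF that sym] by (metis transpose_def vec_lambda_beta)
  have elim: ?case
    if AC: "congruent_mat A C" and CD: "\<And>l j. l \<in> D \<Longrightarrow> j \<noteq> l \<Longrightarrow> C $ l $ j = 0" and nz: "C $ i $ i \<noteq> 0" for C
  proof -
    define w where "w j = (if j = i then 0 else - C $ i $ j / C $ i $ i)" for j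
    define C' where "C' = (\<chi> j k. C $ j $ k + w j * C $ i $ k + w k * C $ j $ i + w j * w k * C $ i $ i)"
    have "congruent_mat C C'" unfolding C'_def by (rule congruent_mat_shear) (simp add: w_def)
    moreover have "C' $ l $ j = 0" if "l \<in> D" "j \<noteq> l" for l j
    proof -
      have "l \<noteq> i" using that insert.hyps by auto
      then have "C $ l $ i = 0" "C $ i $ l = 0" using CD[OF that(1), of i] symm[OF AC] by auto
      then have "w l = 0" by (simp add: w_def)
      then show ?thesis using CD[OF that] \<open>C $ l $ i = 0\<close> by (simp add: C'_def)
    qed
    moreover have "C' $ i $ j = 0" if "j \<noteq> i" for j
      using that nz by (simp add: C'_def w_def)
    ultimately show ?thesis using congruent_mat_trans[OF AC] by (intro exI[of _ C']) auto
  qed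
  show ?case
  proof (cases "\<exists>j. j \<noteq> i \<and> B $ i $ j \<noteq> 0")
    case False
    then show ?thesis using AB D by (intro exI[of _ B]) auto
  next
    case True
    then obtain j where j: "j \<noteq> i" "B $ i $ j \<noteq> 0" by blast
    \<comment> \<open>Rows indexed by \<open>D\<close> are already cleared, so a nonzero entry at
      \<open>i\<close>, \<open>j\<close> keeps \<open>j\<close> out of \<open>D\<close>, and the
      shear along \<open>j\<close> does not disturb those rows.\<close>
    have jD: "j \<notin> D" using D[of j i] j symm[OF AB] by auto
    show ?thesis
    proof (cases "B $ i $ i = 0")
      case False
      then show ?thesis using elim[OF AB D] by blast
    next
      case True
      \<comment> \<open>This is the pivot after replacing e_i by e_i + c e_j. If it vanished for
        both \<open>c = 1\<close> and \<open>c = -1\<close>, the difference would force 4 times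
        \<open>B $ i $ j\<close> to be 0.\<close>
      obtain c where c: "2 * (c * B $ i $ j) + c * c * B $ j $ j \<noteq> 0"
      proof -
        have "False" if "2 * B $ i $ j + B $ j $ j = 0" "- 2 * B $ i $ j + B $ j $ j = 0"
        proof -
          have "(2 * B $ i $ j + B $ j $ j) - (- 2 * B $ i $ j + B $ j $ j) = 2 * (2 * B $ i $ j)"
            by (simp add: algebra_simps)
          then have "2 * (2 * B $ i $ j) = 0" using that by simp
          then show False using two j by (simp only: mult_eq_0_iff) simp
        qed
        then consider "2 * B $ i $ j + B $ j $ j \<noteq> 0" | "- 2 * B $ i $ j + B $ j $ j \<noteq> 0" by blast
        then show thesis
        proof cases
          case 1
          then show ?thesis by (intro that[of 1]) simp
        next
          case 2
          then show ?thesis by (intro that[of "-1"]) simp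
        qed
      qed
      define w where "w l = (if l = i then c else 0)" for l
      define C where "C = (\<chi> a b. B $ a $ b + w a * B $ j $ b + w b * B $ a $ j + w a * w b * B $ j $ j)"
      have "congruent_mat B C" unfolding C_def by (rule congruent_mat_shear) (use j in \<open>simp add: w_def\<close>)
      then have AC: "congruent_mat A C" by (rule congruent_mat_trans[OF AB])
      have "C $ i $ i \<noteq> 0"
        using c True symm[OF AB, of j i] by (simp add: C_def w_def mult.assoc flip: mult_2)
      moreover have "C $ l $ k = 0" if "l \<in> D" "k \<noteq> l" for l k
      proof -
        have "l \<noteq> i" "j \<noteq> l" using that insert.hyps jD by auto
        then show ?thesis using D[OF that] D[OF that(1), of j] by (simp add: C_def w_def)
      qed
      ultimately show ?thesis using elim[OF AC] by blast
    qed
  qed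
qed

lemma congruent_diag_mat:
  fixes A :: "'a::field ^'n ^'n"
  assumes "(2 :: 'a) \<noteq> 0" "transpose A = A"
  obtains a where "congruent_mat A (diag_mat a)"
proof -
  obtain B where B: "congruent_mat A B" "\<And>i j. j \<noteq> i \<Longrightarrow> B $ i $ j = 0"
    using congruent_diagonal_on[OF assms, of UNIV] by blast
  then have "B = diag_mat (\<lambda>i. B $ i $ i)" by (auto simp: diag_mat_def vec_eq_iff)
  then show thesis using B(1) that by metis
qed

section \<open>Classification by the discriminant over a finite field of odd order\<close>

lemma two_neq_0_if_odd_CARD:
  assumes "odd CARD('a::{field,finite})"
  shows "(2 :: 'a) \<noteq> 0"
proof
  assume two: "(2 :: 'a) = 0"
  \<comment> \<open>Translation by 1 permutes the field, so \<open>of_nat CARD('a)\<close> vanishes;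
    for odd \<open>CARD('a)\<close> and \<open>2 = 0\<close> this would read
    \<open>1 = 0\<close>.\<close>
  have "(\<Sum>x\<in>UNIV. x + 1) = (\<Sum>x\<in>UNIV. x :: 'a)"
    by (rule sum.reindex_bij_witness[where i = "\<lambda>x. x - 1" and j = "\<lambda>x. x + 1"]) auto
  then have "of_nat CARD('a) = (0 :: 'a)" by (simp add: sum.distrib)
  moreover obtain k where "CARD('a) = 2 * k + 1" using assms by (rule oddE)
  ultimately show False using two by simp
qed

text \<open>Pigeonhole: more than half of the field elements are squares, so the sets of all
  \<open>a * s\<close> and of all \<open>e - b * s\<close> with \<open>s\<close> a square must
  meet.\<close>

lemma binary_form_represents:
  fixes a b e :: "'a::{field,finite}"
  assumes odd: "odd CARD('a)" and nz: "a \<noteq> 0" "b \<noteq> 0"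
  obtains x y where "a * x\<^sup>2 + b * y\<^sup>2 = e"
proof -
  let ?Sq = "range (\<lambda>x :: 'a. x\<^sup>2)"
  have "card (UNIV :: 'a set) \<le> card (\<Union>s\<in>?Sq. {x. x\<^sup>2 = s})" by (rule card_mono) auto
  also have "\<dots> \<le> (\<Sum>s\<in>?Sq. card {x. x\<^sup>2 = s})" by (rule card_UN_le) simp
  also have "\<dots> \<le> (\<Sum>s\<in>?Sq. 2)"
  proof (rule sum_mono)
    fix s assume "s \<in> ?Sq"
    then obtain r where "s = r\<^sup>2" by blast
    then have "{x. x\<^sup>2 = s} \<subseteq> {r, - r}" by (auto simp: power2_eq_iff)
    then have "card {x. x\<^sup>2 = s} \<le> card {r, - r}" by (intro card_mono) auto
    also have "\<dots> \<le> 2" by (simp add: card_insert_if)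
    finally show "card {x. x\<^sup>2 = s} \<le> 2" .
  qed
  finally have "CARD('a) < 2 * card ?Sq" using odd by (cases "CARD('a) = 2 * card ?Sq") auto
  moreover have "card ((\<lambda>s. a * s) ` ?Sq) = card ?Sq"
    by (rule card_image) (use nz in \<open>auto simp: inj_on_def\<close>)
  moreover have "card ((\<lambda>s. e - b * s) ` ?Sq) = card ?Sq"
    by (rule card_image) (use nz in \<open>auto simp: inj_on_def\<close>)
  moreover have "card ((\<lambda>s. a * s) ` ?Sq \<union> (\<lambda>s. e - b * s) ` ?Sq) \<le> CARD('a)"
    by (rule card_mono) auto
  ultimately have "(\<lambda>s. a * s) ` ?Sq \<inter> (\<lambda>s. e - b * s) ` ?Sq \<noteq> {}"
    using card_Un_disjoint[of "(\<lambda>s. a * s) ` ?Sq" "(\<lambda>s. e - b * s) ` ?Sq"] by auto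
  then obtain x y where "a * x\<^sup>2 = e - b * y\<^sup>2" by auto
  then show thesis by (intro that[of x y]) simp
qed

text \<open>The new basis vectors are \<open>x e\<^sub>i + y e\<^sub>j\<close> and \<open>a\<^sub>i x e\<^sub>j - a\<^sub>j y e\<^sub>i\<close>.\<close>

lemma congruent_diag_mat_represent:
  fixes a :: "'n::finite \<Rightarrow> 'a::field"
  assumes ij: "i \<noteq> j" and e: "e = a i * x\<^sup>2 + a j * y\<^sup>2" "e \<noteq> 0"
  shows "congruent_mat (diag_mat a) (diag_mat (a(i := e, j := a i * a j * e)) :: 'a ^'n ^'n)"
proof -
  define mk :: "('n \<Rightarrow> 'a) \<Rightarrow> ('n \<Rightarrow> 'a) \<Rightarrow> 'a ^'n ^'n"
    where "mk p r = (\<chi> k l. (if k = i then p l else 0) + (if k = j then r l else 0)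
      + (if k = l then (if l = i \<or> l = j then 0 else 1) else 0))" for p r
  let ?u = "\<lambda>l. if l = i \<or> l = j then 0 else 1 :: 'a"
  have mult: "(M ** mk p r) $ k $ l = M $ k $ i * p l + M $ k $ j * r l + M $ k $ l * ?u l" for M p r k l
    by (simp only: mk_def matrix_matrix_mult_def vec_lambda_beta distrib_left sum.distrib sum_mult_delta)
  have tmult: "(transpose (mk p r) ** M) $ k $ l = p k * M $ i $ l + r k * M $ j $ l + ?u k * M $ k $ l"
    for M p r k l
    by (simp only: mk_def matrix_matrix_mult_def transpose_def vec_lambda_beta distrib_right sum.distrib sum_mult_delta)
  define p where "p l = (if l = i then x else if l = j then - a j * y else 0)" for l
  define r where "r l = (if l = i then y else if l = j then a i * x else 0)" for l
  \<comment> \<open>The 2 by 2 block with rows \<open>p\<close> and \<open>r\<close> has determinant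
    \<open>e\<close>; \<open>p'\<close> and \<open>r'\<close> are the rows of its adjugate divided
    by \<open>e\<close>.\<close>
  define p' where "p' l = (if l = i then a i * x / e else if l = j then a j * y / e else 0)" for l
  define r' where "r' l = (if l = i then - y / e else if l = j then x / e else 0)" for l
  have 1: "a i * x / e * x + a j * y / e * y = 1"
    using e by (simp add: power2_eq_square add_divide_distrib[symmetric] mult.assoc)
  have 2: "- y / e * (- a j * y) + x / e * (a i * x) = 1"
    using e by (simp add: power2_eq_square add_divide_distrib[symmetric] algebra_simps)
  have "(mk p' r' ** mk p r) $ k $ l = mat 1 $ k $ l" for k l
    unfolding mult using ij 1 2
    by (auto simp: mk_def p_def r_def p'_def r'_def mat_def)
  then have "invertible (mk p r)" unfolding invertible_left_inverse by (metis vec_eq_iff)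
  moreover have "(transpose (mk p r) ** diag_mat a ** mk p r) $ k $ l
      = diag_mat (a(i := e, j := a i * a j * e)) $ k $ l" for k l
    unfolding mult tmult using ij
    by (auto simp: diag_mat_def p_def r_def e(1) power2_eq_square algebra_simps)
  ultimately show ?thesis
    unfolding congruent_mat_def by (intro exI[of _ "mk p r"]) (simp add: vec_eq_iff)
qed

text \<open>The entries are prescribed one at a time: the binary form on \<open>i\<close> and a
  spare index \<open>j\<close> outside \<open>insert i D\<close> represents \<open>d i\<close>. One
  index has to stay free, because the determinant is fixed up to squares.\<close>

lemma congruent_diag_mat_prescribed:
  fixes A :: "'a::{field,finite} ^'n ^'n"
  assumes odd: "odd CARD('a)" and sym: "transpose A = A" and nondeg: "det A \<noteq> 0"
    and d: "\<And>i. d i \<noteq> 0" and D: "D \<noteq> UNIV"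
  shows "\<exists>a. congruent_mat A (diag_mat a) \<and> (\<forall>i\<in>D. a i = d i)"
  using finite[of D] D
proof (induction D)
  case empty
  then show ?case using congruent_diag_mat[OF two_neq_0_if_odd_CARD[OF odd] sym] by auto
next
  case (insert i D)
  then obtain a where a: "congruent_mat A (diag_mat a)" "\<forall>i\<in>D. a i = d i" by blast
  obtain j where j: "j \<notin> insert i D" using insert.prems by blast
  obtain s where "s \<noteq> 0" "det (diag_mat a) = s\<^sup>2 * det A" using congruent_mat_det[OF a(1)] .
  then have "prod a UNIV \<noteq> 0" using nondeg by (simp add: det_diag_mat)
  then have "a i \<noteq> 0" "a j \<noteq> 0" by auto
  then obtain x y where "a i * x\<^sup>2 + a j * y\<^sup>2 = d i" using binary_form_represents[OF odd] by blast
  then have "congruent_mat (diag_mat a) (diag_mat (a(i := d i, j := a i * a j * d i)) :: 'a ^'n ^'n)"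
    using j d by (intro congruent_diag_mat_represent[where x = x and y = y]) auto
  then have "congruent_mat A (diag_mat (a(i := d i, j := a i * a j * d i)))"
    by (rule congruent_mat_trans[OF a(1)])
  then show ?case using a(2) j insert.hyps by (intro exI conjI) auto
qed

text \<open>After all entries but the one at \<open>k\<close> are prescribed, comparing determinants
  shows that \<open>a k\<close> and \<open>d k\<close> differ by a square factor, which a rescaling
  of one basis vector absorbs.\<close>

lemma congruent_diag_mat_if_square:
  fixes A :: "'a::{field,finite} ^'n ^'n"
  assumes odd: "odd CARD('a)" and sym: "transpose A = A" and nondeg: "det A \<noteq> 0"
    and d: "\<And>i. d i \<noteq> 0" and sq: "prod d UNIV * det A = c\<^sup>2"
  shows "congruent_mat A (diag_mat d)"
proof -
  define k :: 'n where "k = undefined"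
  obtain a where a: "congruent_mat A (diag_mat a)" "\<forall>i\<in>UNIV - {k}. a i = d i"
    using congruent_diag_mat_prescribed[OF odd sym nondeg, of d "UNIV - {k}"] d by auto
  obtain s where s: "s \<noteq> 0" "det (diag_mat a) = s\<^sup>2 * det A" using congruent_mat_det[OF a(1)] .
  define R where "R = prod d (UNIV - {k})"
  have "R \<noteq> 0" using d by (simp add: R_def)
  have "prod d UNIV = d k * R" "prod a UNIV = a k * R"
    using a(2) by (simp_all add: R_def prod.remove[of UNIV k])
  then have dd: "d k * R * det A = c\<^sup>2" and aa: "a k * R = s\<^sup>2 * det A"
    using sq s(2) by (simp_all add: det_diag_mat)
  have "c \<noteq> 0" using dd d[of k] \<open>R \<noteq> 0\<close> nondeg by auto
  \<comment> \<open>Chosen so that \<open>a k * t\<^sup>2 = d k\<close>, by multiplying the two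
    determinant relations \<open>aa\<close> and \<open>dd\<close>.\<close>
  define t where "t = d k * R / (s * c)"
  have t: "t \<noteq> 0" using \<open>R \<noteq> 0\<close> \<open>c \<noteq> 0\<close> s(1) d[of k] by (simp add: t_def)
  have "a k * t\<^sup>2 = (a k * R) * (d k * R) * d k / (s\<^sup>2 * c\<^sup>2)"
    by (simp add: t_def power2_eq_square mult_ac)
  also have "\<dots> = d k"
    using s(1) \<open>R \<noteq> 0\<close> d[of k] nondeg unfolding aa dd[symmetric] by (simp add: field_simps)
  finally have at: "a k * t\<^sup>2 = d k" .
  \<comment> \<open>With this \<open>w\<close> the shear is the scaling of the basis vector at
    \<open>k\<close> by \<open>t\<close>.\<close>
  define w where "w l = (if l = k then t - 1 else 0)" for l
  let ?D = "diag_mat a :: 'a ^'n ^'n"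
  have "congruent_mat ?D (\<chi> i j. ?D $ i $ j + w i * ?D $ k $ j + w j * ?D $ i $ k + w i * w j * ?D $ k $ k)"
    by (rule congruent_mat_shear) (simp add: w_def t)
  also have "(\<chi> i j. ?D $ i $ j + w i * ?D $ k $ j + w j * ?D $ i $ k + w i * w j * ?D $ k $ k) = diag_mat d"
  proof -
    have "a k + (t - 1) * a k + (t - 1) * a k + (t - 1) * (t - 1) * a k = d k"
      by (simp add: at[symmetric] power2_eq_square algebra_simps)
    then show ?thesis using a(2) by (auto simp: vec_eq_iff diag_mat_def w_def)
  qed
  finally show ?thesis using congruent_mat_trans[OF a(1)] by blast
qed

section \<open>From the diagonal to the hyperbolic form\<close>

lemma qf_poly_diag_mat: "qf_poly (diag_mat d) x = (\<Sum>i\<in>UNIV. smult (d i) ((x $ i)\<^sup>2))"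
proof -
  have "poly_mat_apply (diag_mat d) x $ i = smult (d i) (x $ i)" for i
  proof -
    have "poly_mat_apply (diag_mat d) x $ i = (\<Sum>j\<in>UNIV. if i = j then smult (d i) (x $ j) else 0)"
      unfolding poly_mat_apply_def diag_mat_def vec_lambda_beta by (intro sum.cong) auto
    then show ?thesis by simp
  qed
  then show ?thesis by (simp add: qf_poly_eq power2_eq_square)
qed

text \<open>The bijection \<sigma> pairs each coefficient 1 with a coefficient -1, and each
  difference of two squares factors. The change of variables has scalar entries and is invertible as
  \<open>2 \<noteq> 0\<close>, so degree bounds survive both ways.\<close>

lemma card_zeros_below_diag_mat:
  fixes \<sigma> :: "'n::finite \<Rightarrow> 'n" and k :: nat
  assumes two: "(2 :: 'a::{field,finite}) \<noteq> 0" and \<sigma>: "bij_betw \<sigma> H (- H)"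
  defines "X \<equiv> H \<rightarrow>\<^sub>E (polys_below k :: 'a poly set)"
  shows "card (zeros_below (diag_mat (\<lambda>i. if i \<in> H then 1 else - 1) :: 'a ^'n ^'n) k)
    = card {p \<in> X \<times> X. (\<Sum>h\<in>H. fst p h * snd p h) = 0}"
proof -
  let ?d = "\<lambda>i. if i \<in> H then 1 else - 1 :: 'a"
  define \<rho> where "\<rho> = the_inv_into H \<sigma>"
  have \<sigma>H: "\<sigma> h \<notin> H" if "h \<in> H" for h using \<sigma> that by (auto simp: bij_betw_def)
  have \<rho>\<sigma>: "\<rho> (\<sigma> h) = h" if "h \<in> H" for h
    using \<sigma> that by (simp add: \<rho>_def bij_betw_def the_inv_into_f_f)
  have \<sigma>\<rho>: "\<sigma> (\<rho> i) = i" "\<rho> i \<in> H" if "i \<notin> H" for i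
    using \<sigma> that by (auto simp: \<rho>_def bij_betw_def f_the_inv_into_f intro: the_inv_into_into)
  define f where "f x = (\<lambda>h\<in>H. x $ h - x $ \<sigma> h, \<lambda>h\<in>H. x $ h + x $ \<sigma> h)" for x :: "'a poly ^'n"
  define g :: "('n \<Rightarrow> 'a poly) \<times> ('n \<Rightarrow> 'a poly) \<Rightarrow> 'a poly ^'n"
    where "g = (\<lambda>(u, v). \<chi> i. if i \<in> H then smult (1/2) (v i + u i)
      else smult (1/2) (v (\<rho> i) - u (\<rho> i)))"
  have half: "smult (1/2) (a + a) = a" for a :: "'a poly"
  proof -
    have "smult (1/2) (a + a) = smult (1 / 2 + 1 / 2) a" by (simp only: smult_add_right smult_add_left)
    also have "(1 / 2 + 1 / 2 :: 'a) = 1" using two by (simp add: add_divide_distrib[symmetric])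
    finally show ?thesis by simp
  qed
  have qf: "qf_poly (diag_mat ?d) x = (\<Sum>h\<in>H. fst (f x) h * snd (f x) h)" for x
  proof -
    have "qf_poly (diag_mat ?d) x = (\<Sum>i\<in>H. smult (?d i) ((x $ i)\<^sup>2)) + (\<Sum>i\<in>-H. smult (?d i) ((x $ i)\<^sup>2))"
      unfolding qf_poly_diag_mat by (subst sum.union_disjoint[symmetric]) auto
    also have "(\<Sum>i\<in>-H. smult (?d i) ((x $ i)\<^sup>2)) = (\<Sum>h\<in>H. smult (?d (\<sigma> h)) ((x $ \<sigma> h)\<^sup>2))"
      by (rule sum.reindex_bij_betw[OF \<sigma>, symmetric])
    finally show ?thesis
      by (simp add: \<sigma>H f_def sum.distrib[symmetric] power2_eq_square algebra_simps cong: sum.cong)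
  qed
  have fg: "f (g p) = p" if pX: "p \<in> X \<times> X" for p
  proof -
    obtain u v where p: "p = (u, v)" and uv: "u \<in> X" "v \<in> X" using pX by blast
    have gh: "g p $ h = smult (1/2) (v h + u h)" "g p $ \<sigma> h = smult (1/2) (v h - u h)" if "h \<in> H" for h
      using that by (simp_all add: g_def p \<sigma>H \<rho>\<sigma>)
    have "g p $ h - g p $ \<sigma> h = u h" "g p $ h + g p $ \<sigma> h = v h" if "h \<in> H" for h
    proof -
      have "(v h + u h) - (v h - u h) = u h + u h" "(v h + u h) + (v h - u h) = v h + v h" by simp_all
      then show "g p $ h - g p $ \<sigma> h = u h" "g p $ h + g p $ \<sigma> h = v h"
        by (simp_all only: gh[OF that] half flip: smult_diff_right smult_add_right)
    qed
    then have "f (g p) = (restrict u H, restrict v H)" by (auto simp: f_def restrict_def)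
    then show ?thesis using uv by (simp add: p X_def PiE_restrict)
  qed
  have gf: "g (f x) = x" for x
  proof -
    have "g (f x) $ i = x $ i" for i
    proof (cases "i \<in> H")
      case True
      have "(x $ i + x $ \<sigma> i) + (x $ i - x $ \<sigma> i) = x $ i + x $ i" by simp
      moreover have "g (f x) $ i = smult (1/2) ((x $ i + x $ \<sigma> i) + (x $ i - x $ \<sigma> i))"
        using True by (simp add: g_def f_def)
      ultimately show ?thesis by (simp only: half)
    next
      case False
      have "(x $ \<rho> i + x $ i) - (x $ \<rho> i - x $ i) = x $ i + x $ i" by simp
      moreover have "g (f x) $ i = smult (1/2) ((x $ \<rho> i + x $ i) - (x $ \<rho> i - x $ i))"
        using False \<sigma>\<rho>[of i] by (simp add: g_def f_def)
      ultimately show ?thesis by (simp only: half)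
    qed
    then show ?thesis by (simp add: vec_eq_iff)
  qed
  have fX: "f x \<in> X \<times> X" if "\<forall>i. x $ i \<in> polys_below k" for x
    using that by (auto simp: f_def X_def diff_in_polys_below add_in_polys_below)
  have gX: "g p $ i \<in> polys_below k" if "p \<in> X \<times> X" for p i
    using that \<sigma>\<rho>(2)[of i]
    by (auto simp: g_def X_def PiE_iff intro!: smult_in_polys_below diff_in_polys_below add_in_polys_below)
  have "bij_betw f (zeros_below (diag_mat ?d) k) {p \<in> X \<times> X. (\<Sum>h\<in>H. fst p h * snd p h) = 0}"
  proof (rule bij_betw_byWitness[where f' = g])
    show "\<forall>x\<in>zeros_below (diag_mat ?d) k. g (f x) = x" by (simp add: gf)
    show "\<forall>p\<in>{p \<in> X \<times> X. (\<Sum>h\<in>H. fst p h * snd p h) = 0}. f (g p) = p" using fg by blast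
    show "f ` zeros_below (diag_mat ?d) k \<subseteq> {p \<in> X \<times> X. (\<Sum>h\<in>H. fst p h * snd p h) = 0}"
      using fX by (intro image_subsetI) (simp add: zeros_below_def qf)
    show "g ` {p \<in> X \<times> X. (\<Sum>h\<in>H. fst p h * snd p h) = 0} \<subseteq> zeros_below (diag_mat ?d) k"
      using gX fg by (intro image_subsetI) (simp add: zeros_below_def qf)
  qed
  then show ?thesis by (rule bij_betw_same_card)
qed

text \<open>The diagonal form with \<open>m\<close> entries 1 and \<open>m\<close> entries -1 has
  determinant \<open>(-1) ^ m\<close>, so the hypothesis on \<open>c\<close> puts \<open>A\<close>
  in its congruence class. The rest combines the double count with the \<open>m\<close>-th moment
  for the square Hankel matrix.\<close>

lemma card_zeros_below_split:
  fixes A :: "'a::{field,finite} ^'n ^'n"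
  assumes odd: "odd CARD('a)" and n: "CARD('n) = 2 * m"
    and sym: "transpose A = A" and nondeg: "det A \<noteq> 0"
    and sq: "c ^ 2 = (-1) ^ m * det A"
  defines "q \<equiv> real CARD('a)"
  shows "real (card (zeros_below A (Suc k))) * q ^ Suc (2 * k)
    = q ^ (Suc k * m) * (q ^ Suc (2 * k) + (q ^ m - 1) * (\<Sum>j<Suc k. q ^ (2 * j) * q ^ (m * (k - j))))"
proof -
  obtain H :: "'n set" where H: "card H = m"
    using obtain_subset_with_card_n[of m "UNIV :: 'n set"] n by auto
  have H': "card (- H) = m" using n H by (simp add: Compl_eq_Diff_UNIV card_Diff_subset)
  obtain \<sigma> where \<sigma>: "bij_betw \<sigma> H (- H)"
    using finite_same_card_bij[of H "- H"] H H' by auto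
  let ?d = "\<lambda>i. if i \<in> H then 1 else - 1 :: 'a"
  have "prod ?d UNIV = (\<Prod>i\<in>H. ?d i) * (\<Prod>i\<in>-H. ?d i)"
    by (subst prod.union_disjoint[symmetric]) auto
  also have "\<dots> = (-1) ^ m" by (simp add: H')
  finally have "congruent_mat A (diag_mat ?d)"
    using sq by (intro congruent_diag_mat_if_square[OF odd sym nondeg, where c = c]) auto
  from card_zeros_below_congruent[OF this, of "Suc k"]
  show ?thesis
    using card_hyperbolic_zeros_multiple[of H k, where 'a='a]
      sum_hankel_kernel_power[of "Suc k" "Suc (2 * k)" m, where 'a='a]
      card_zeros_below_diag_mat[OF two_neq_0_if_odd_CARD[OF odd] \<sigma>, of "Suc k"]
    by (simp add: H q_def)
qed

subsection \<open>Counting zeros and morphisms\<close>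

lemma card_zeros_below_0: "card (zeros_below A 0) = 1"
proof -
  have "zeros_below A 0 = {0}"
    by (auto simp: zeros_below_def vec_eq_iff qf_poly_def)
  then show ?thesis by simp
qed

text \<open>For \<open>m = 2\<close> all \<open>k\<close> terms of the moment sum coincide; this is
  the source of the term linear in the degree.\<close>

lemma card_zeros_below_4:
  fixes A :: "'a::{field,finite} ^'n ^'n"
  assumes "odd CARD('a)" "CARD('n) = 2 * 2" "transpose A = A" "det A \<noteq> 0" "c ^ 2 = (-1) ^ 2 * det A"
  defines "q \<equiv> real CARD('a)"
  shows "q * real (card (zeros_below A k)) = q ^ (2 * k) * (q + (q\<^sup>2 - 1) * real k)"
proof (cases k)
  case 0
  then show ?thesis by (simp add: card_zeros_below_0)
next
  case (Suc l)
  have q: "q > 0" by (simp add: q_def)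
  have "q ^ (2 * j) * q ^ (2 * (l - j)) = q ^ (2 * l)" if "j \<in> {..<Suc l}" for j
  proof -
    have "2 * j + 2 * (l - j) = 2 * l" using that by auto
    then show ?thesis by (simp flip: power_add)
  qed
  then have "(\<Sum>j<Suc l. q ^ (2 * j) * q ^ (2 * (l - j))) = (\<Sum>j<Suc l. q ^ (2 * l))"
    by (rule sum.cong[OF refl])
  also have "\<dots> = real k * q ^ (2 * l)" by (simp add: Suc)
  finally have sum: "(\<Sum>j<Suc l. q ^ (2 * j) * q ^ (2 * (l - j))) = real k * q ^ (2 * l)" .
  have "real (card (zeros_below A k)) * q ^ Suc (2 * l)
      = q ^ (k * 2) * (q ^ Suc (2 * l) + (q\<^sup>2 - 1) * (real k * q ^ (2 * l)))"
    using card_zeros_below_split[OF assms(1-5), of l] unfolding q_def[symmetric] sum unfolding Suc .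
  then have "q ^ (2 * l) * (q * real (card (zeros_below A k)))
      = q ^ (2 * l) * (q ^ (2 * k) * (q + (q\<^sup>2 - 1) * real k))"
    by (simp add: algebra_simps)
  then show ?thesis using q by simp
qed

text \<open>The moment sum is now geometric with the two bases \<open>a\<close> and
  \<open>q\<^sup>2\<close>. Its denominator \<open>a - q\<^sup>2\<close> is kept on the left, which
  leaves a combination of \<open>b ^ k\<close> and \<open>a ^ k\<close>.\<close>

lemma card_zeros_below_ge_6:
  fixes A :: "'a::{field,finite} ^'n ^'n"
  assumes "odd CARD('a)" "CARD('n) = 2 * m" "transpose A = A" "det A \<noteq> 0" "c ^ 2 = (-1) ^ m * det A"
    and m: "m \<ge> 3"
  defines "q \<equiv> real CARD('a)"
  defines "a \<equiv> q ^ m" and "b \<equiv> q ^ (2 * m - 2)"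
  shows "real (card (zeros_below A k)) * (a - q\<^sup>2) = q * (a - 1) * b ^ k - (q - 1) * (a + q) * a ^ k"
proof (cases k)
  case 0
  then show ?thesis by (simp add: card_zeros_below_0 algebra_simps power2_eq_square)
next
  case (Suc l)
  have q: "q > 0" by (simp add: q_def)
  have "2 + (2 * m - 2) = m + m" using m by simp
  then have b: "q\<^sup>2 * b = a * a" unfolding a_def b_def by (metis power_add)
  define S where "S = (\<Sum>j<Suc l. q ^ (2 * j) * q ^ (m * (l - j)))"
  have "S = (\<Sum>i<k. a ^ (k - Suc i) * (q\<^sup>2) ^ i)"
    unfolding S_def Suc a_def power_mult by (rule sum.cong) (auto simp: mult.commute)
  then have geo: "(a - q\<^sup>2) * S = a ^ k - q ^ (2 * k)"
    using power_diff_sumr2[of "q\<^sup>2" k a] by (simp add: power_mult left_diff_distrib)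
  have ak: "q ^ (k * m) = a ^ k" by (simp add: a_def mult.commute flip: power_mult)
  have qk: "q ^ (2 * k) = q * q ^ Suc (2 * l)" by (simp add: Suc)
  have bk: "q ^ (2 * k) * b ^ k = a ^ k * a ^ k"
    unfolding power_mult power_mult_distrib[symmetric] b ..
  have split: "real (card (zeros_below A k)) * q ^ Suc (2 * l) = a ^ k * (q ^ Suc (2 * l) + (a - 1) * S)"
    using card_zeros_below_split[OF assms(1-5), of l]
    unfolding q_def[symmetric] S_def[symmetric] a_def[symmetric] unfolding Suc[symmetric] ak .
  have "real (card (zeros_below A k)) * q ^ Suc (2 * l) * (a - q\<^sup>2)
      = a ^ k * (q ^ Suc (2 * l) * (a - q\<^sup>2) + (a - 1) * ((a - q\<^sup>2) * S))"
    unfolding split by (simp add: algebra_simps)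
  moreover have "real (card (zeros_below A k)) * q ^ (2 * k) * (a - q\<^sup>2)
      = q * (real (card (zeros_below A k)) * q ^ Suc (2 * l) * (a - q\<^sup>2))"
    unfolding qk by (simp only: mult_ac)
  ultimately have "real (card (zeros_below A k)) * q ^ (2 * k) * (a - q\<^sup>2)
      = a ^ k * (q * q ^ Suc (2 * l) * (a - q\<^sup>2) + q * (a - 1) * (a ^ k - q ^ (2 * k)))"
    unfolding geo by (simp only: distrib_left mult_ac)
  also have "\<dots> = q ^ (2 * k) * (a ^ k * (a - q\<^sup>2 - q * (a - 1))) + q * (a - 1) * (a ^ k * a ^ k)"
    unfolding qk[symmetric] by (simp add: algebra_simps)
  also have "\<dots> = q ^ (2 * k) * (q * (a - 1) * b ^ k - (q - 1) * (a + q) * a ^ k)"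
    unfolding bk[symmetric] by (simp add: algebra_simps power2_eq_square)
  finally have "q ^ (2 * k) * (real (card (zeros_below A k)) * (a - q\<^sup>2))
      = q ^ (2 * k) * (q * (a - 1) * b ^ k - (q - 1) * (a + q) * a ^ k)"
    by (simp add: mult_ac)
  then show ?thesis using q by simp
qed

theorem theorem1p1:
  fixes A :: "'a::{field,finite} ^'n ^'n" and P :: nat
  assumes odd_q: "odd CARD('a)"
    and n_even: "even CARD('n)" and n_ge: "CARD('n) \<ge> 4"
    and sym: "transpose A = A"
    and nondeg: "det A \<noteq> 0"
    and square: "\<exists>c::'a. c \<noteq> 0 \<and> c ^ 2 = (-1) ^ (CARD('n) div 2) * det A"
    and P_ge: "P \<ge> 1"
  shows "let q = real CARD('a); n = CARD('n) in
    (n = 4 \<longrightarrow> num_mor A P =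
        (q^2 - 1)^2 / q^2 * real P * q^(2*P) + (q^2 - 1) * (q + 1)^2 / q^2 * q^(2*P))
  \<and> (n \<ge> 6 \<longrightarrow> num_mor A P =
        (q^(n div 2) - 1) * (q^(n-2) - 1) * (q^(n-3) - 1)
          / (q^(n-2) * (q^(n div 2 - 2) - 1) * (q - 1)) * q^(P*(n-2))
      - (q^(n-2) - 1) * (q^(n div 2) - 1) / (q^(n div 2) * (q^(n div 2 - 2) - 1)) * q^((n div 2) * P))"
proof -
  define q where "q = real CARD('a)"
  have q: "q \<ge> 2" using CARD_ge_2[where 'a='a] by (simp add: q_def)
  obtain m where m: "CARD('n) = 2 * m" using n_even by (rule evenE)
  obtain c where c: "c ^ 2 = (-1) ^ m * det A" using square m by auto
  obtain k where k: "P = Suc k" using P_ge by (cases P) auto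
  define M where "M = real (card (mor_vectors A P))"
  let ?z = "\<lambda>j. real (card (zeros_below A j))"
  have M: "M = ?z (Suc (Suc k)) - (q + 1) * ?z (Suc k) + q * ?z k"
    using card_mor_vectors[of A k] by (simp add: M_def k q_def)
  have num: "num_mor A P = M / (q - 1)" by (simp add: num_mor_def M_def q_def)
  have four: "num_mor A P = (q^2 - 1)^2 / q^2 * real P * q^(2*P) + (q^2 - 1) * (q + 1)^2 / q^2 * q^(2*P)"
    if "m = 2"
  proof -
    have z: "q * ?z j = q ^ (2 * j) * (q + (q\<^sup>2 - 1) * real j)" for j
      using card_zeros_below_4[OF odd_q _ sym nondeg, of c j] m c that by (simp add: q_def)
    have "q * M = q * ?z (Suc (Suc k)) - (q + 1) * (q * ?z (Suc k)) + q * (q * ?z k)"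
      by (simp add: M algebra_simps)
    also have "\<dots> = q * ((q - 1) * (q ^ (2 * k) * ((q\<^sup>2 - 1)\<^sup>2 * real P + (q\<^sup>2 - 1) * (q + 1)\<^sup>2)))"
      unfolding z by (simp add: k algebra_simps power2_eq_square)
    finally have "M = (q - 1) * (q ^ (2 * k) * ((q\<^sup>2 - 1)\<^sup>2 * real P + (q\<^sup>2 - 1) * (q + 1)\<^sup>2))"
      using q by simp
    then have "num_mor A P = q ^ (2 * k) * ((q\<^sup>2 - 1)\<^sup>2 * real P + (q\<^sup>2 - 1) * (q + 1)\<^sup>2)"
      using q by (simp add: num)
    moreover have "q ^ (2 * P) = q\<^sup>2 * q ^ (2 * k)" by (simp add: k power2_eq_square)
    ultimately show ?thesis using q by (simp add: distrib_left mult_ac)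
  qed
  have six: "num_mor A P = (q^m - 1) * (q^(2 * m - 2) - 1) * (q^(2 * m - 3) - 1)
          / (q^(2 * m - 2) * (q^(m - 2) - 1) * (q - 1)) * q^(P*(2 * m - 2))
      - (q^(2 * m - 2) - 1) * (q^m - 1) / (q^m * (q^(m - 2) - 1)) * q^(m * P)"
    if m3: "m \<ge> 3"
  proof -
    \<comment> \<open>With these names the identities \<open>a = q\<^sup>2 * d\<close>,
      \<open>b = q * e\<close> and \<open>a * a = q\<^sup>2 * b\<close> reduce the claim to
      polynomial algebra.\<close>
    define a b e d where "a = q ^ m" and "b = q ^ (2 * m - 2)" and "e = q ^ (2 * m - 3)" and "d = q ^ (m - 2)"
    have z: "?z j * (a - q\<^sup>2) = q * (a - 1) * b ^ j - (q - 1) * (a + q) * a ^ j" for j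
      using card_zeros_below_ge_6[OF odd_q m sym nondeg c m3, of j] by (simp only: q_def a_def b_def)
    have exps: "m = 2 + (m - 2)" "2 * m - 2 = Suc (2 * m - 3)" "2 + (2 * m - 2) = m + m" using m3 by simp_all
    have ad: "a = q\<^sup>2 * d" unfolding a_def d_def by (metis exps(1) power_add)
    have be: "b = q * e" unfolding b_def e_def by (metis exps(2) power_Suc)
    have ab: "a * a = q\<^sup>2 * b" unfolding a_def b_def by (metis exps(3) power_add)
    have "d > 1" unfolding d_def using q m3 by (intro one_less_power) auto
    have nz: "a \<noteq> 0" "b \<noteq> 0" "q \<noteq> 0" "q - 1 \<noteq> 0" "d - 1 \<noteq> 0"
      using q \<open>d > 1\<close> by (auto simp: a_def b_def)
    have "M * (a - q\<^sup>2) = ?z (Suc (Suc k)) * (a - q\<^sup>2) - (q + 1) * (?z (Suc k) * (a - q\<^sup>2)) + q * (?z k * (a - q\<^sup>2))"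
      by (simp add: M algebra_simps)
    \<comment> \<open>The second difference multiplies \<open>b ^ k\<close> by
      \<open>(b - 1) * (b - q)\<close> and \<open>a ^ k\<close> by \<open>(a - 1) * (a - q)\<close>;
      the latter meets the coefficient \<open>a + q\<close> and yields
      \<open>a * a - q\<^sup>2\<close>.\<close>
    also have "\<dots> = q * (a - 1) * (b - 1) * (b - q) * b ^ k - (q - 1) * (a - 1) * (a * a - q\<^sup>2) * a ^ k"
      unfolding z by (simp add: algebra_simps power2_eq_square)
    also have "\<dots> = q\<^sup>2 * ((a - 1) * (b - 1) * (e - 1) * b ^ k - (q - 1) * (a - 1) * (b - 1) * a ^ k)"
      unfolding ab by (simp add: be[symmetric] algebra_simps power2_eq_square) (simp add: be algebra_simps)
    finally have "q\<^sup>2 * (M * (d - 1)) = q\<^sup>2 * ((a - 1) * (b - 1) * (e - 1) * b ^ k - (q - 1) * (a - 1) * (b - 1) * a ^ k)"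
      by (simp add: ad algebra_simps)
    then have "M * (d - 1) = (a - 1) * (b - 1) * (e - 1) * b ^ k - (q - 1) * (a - 1) * (b - 1) * a ^ k"
      using nz by simp
    then have "M = ((a - 1) * (b - 1) * (e - 1) * b ^ k - (q - 1) * (a - 1) * (b - 1) * a ^ k) / (d - 1)"
      using nz by (simp add: eq_divide_eq)
    then have "num_mor A P = (a - 1) * (b - 1) * (e - 1) / (b * (d - 1) * (q - 1)) * b ^ P
        - (b - 1) * (a - 1) / (a * (d - 1)) * a ^ P"
      unfolding num using nz by (simp add: k diff_divide_distrib mult_ac)
    moreover have "q ^ (P * (2 * m - 2)) = b ^ P" "q ^ (m * P) = a ^ P"
      by (simp_all add: a_def b_def mult.commute flip: power_mult)
    ultimately show ?thesis by (simp only: a_def b_def d_def e_def)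
  qed
  show ?thesis
    using four six unfolding Let_def q_def m by simp
qed

end
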